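(* The Horn clone $\mathscr H$ has automatic homeomorphicity.
   Context: Let $D$ be a countably infinite set and $\mathscr O_D$ the set of all operations $D^n\to D$, $n\ge1$, with the topology of pointwise convergence ($D$ discrete; for each $n$ the $n$-ary operations form a clopen set); $\mathbf O$ denotes the corresponding topological clone. A function clone on $D$ is a subset of $\mathscr O_D$ containing all projections $\pi^n_k(x_1,\dots,x_n)=x_k$ and closed under composition $f(g_1,\dots,g_n)$; it is closed if closed in $\mathscr O_D$. The Horn clone $\mathscr H$ is the smallest closed function clone on $D$ containing all injections from finite powers of $D$ into $D$; it consists of all functions of the form $f(\pi^n_{i_1}(x_1,\dots,x_n),\dots,\pi^n_{i_k}(x_1,\dots,x_n))$ with $1\le k\le n$, $f\colon D^k\to D$ injective and $1\le i_1<\dots<i_k\le n$. A clone homomorphism is a map between function clones preserving arities, projections and composition; an isomorphism is a bijective homomorphism. A closed subclone $\mathbf C$ of $\mathbf O$ (i.e. a closed function clone on a countably infinite set) has automatic homeomorphicity if every clone isomorphism between $\mathbf C$ and a closed subclone of $\mathbf O$ is a homeomorphism. *)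

theory Defs
  imports "HOL-Analysis.Analysis"
begin

text \<open>
  The base set \<open>D\<close> is the universe of a type \<open>'a\<close>. An operation is a pair of its arity and
  an extensional function on tuples (lists) of that length; the arity has to be recorded because
  the function that is constantly \<open>undefined\<close> belongs to \<open>tuples n \<rightarrow>\<^sub>E UNIV\<close> for every \<open>n\<close>.
\<close>

type_synonym 'a operation = "nat \<times> ('a list \<Rightarrow> 'a)"

definition tuples :: "nat \<Rightarrow> 'a list set" where
  "tuples n = {xs. length xs = n}"

definition operations :: "'a operation set" where
  "operations = (SIGMA n:{1..}. tuples n \<rightarrow>\<^sub>E UNIV)"

abbreviation arity :: "'a operation \<Rightarrow> nat" where
  "arity \<equiv> fst"

abbreviation fun_of :: "'a operation \<Rightarrow> 'a list \<Rightarrow> 'a" where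
  "fun_of \<equiv> snd"

definition operation_topology :: "'a operation topology" where
  "operation_topology =
     sum_topology (\<lambda>n. product_topology (\<lambda>_. discrete_topology UNIV) (tuples n)) {1..}"

text \<open>Arguments are numbered from \<open>0\<close>, so \<open>projection n k\<close> is meant for \<open>k < n\<close>.\<close>

definition projection :: "nat \<Rightarrow> nat \<Rightarrow> 'a operation" where
  "projection n k = (n, \<lambda>xs\<in>tuples n. xs ! k)"

definition composition :: "nat \<Rightarrow> 'a operation \<Rightarrow> 'a operation list \<Rightarrow> 'a operation" where
  "composition m f gs = (m, \<lambda>xs\<in>tuples m. fun_of f (map (\<lambda>g. fun_of g xs) gs))"

definition function_clone :: "'a operation set \<Rightarrow> bool" where
  "function_clone C \<longleftrightarrow>
     C \<subseteq> operations \<and>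
     (\<forall>n\<ge>1. \<forall>k<n. projection n k \<in> C) \<and>
     (\<forall>f\<in>C. \<forall>m gs. length gs = arity f \<longrightarrow> (\<forall>g\<in>set gs. g \<in> C \<and> arity g = m) \<longrightarrow>
        composition m f gs \<in> C)"

definition closed_function_clone :: "'a operation set \<Rightarrow> bool" where
  "closed_function_clone C \<longleftrightarrow> function_clone C \<and> closedin operation_topology C"

definition injections :: "'a operation set" where
  "injections = {f \<in> operations. inj_on (fun_of f) (tuples (arity f))}"

definition Horn_clone :: "'a operation set" where
  "Horn_clone = \<Inter>{C. closed_function_clone C \<and> injections \<subseteq> C}"

definition clone_homomorphism ::
    "'a operation set \<Rightarrow> 'b operation set \<Rightarrow> ('a operation \<Rightarrow> 'b operation) \<Rightarrow> bool" where
  "clone_homomorphism C C' \<xi> \<longleftrightarrow>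
     \<xi> \<in> C \<rightarrow> C' \<and>
     (\<forall>f\<in>C. arity (\<xi> f) = arity f) \<and>
     (\<forall>n\<ge>1. \<forall>k<n. \<xi> (projection n k) = projection n k) \<and>
     (\<forall>f\<in>C. \<forall>m gs. length gs = arity f \<longrightarrow> (\<forall>g\<in>set gs. g \<in> C \<and> arity g = m) \<longrightarrow>
        \<xi> (composition m f gs) = composition m (\<xi> f) (map \<xi> gs))"

definition clone_isomorphism ::
    "'a operation set \<Rightarrow> 'b operation set \<Rightarrow> ('a operation \<Rightarrow> 'b operation) \<Rightarrow> bool" where
  "clone_isomorphism C C' \<xi> \<longleftrightarrow> clone_homomorphism C C' \<xi> \<and> bij_betw \<xi> C C'"

definition automatic_homeomorphicity :: "'a operation set \<Rightarrow> bool" where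
  "automatic_homeomorphicity C \<longleftrightarrow>
     (\<forall>(C' :: 'a operation set) \<xi>. closed_function_clone C' \<longrightarrow> clone_isomorphism C C' \<xi> \<longrightarrow>
        homeomorphic_map (subtopology operation_topology C) (subtopology operation_topology C') \<xi>)"

lemma topspace_operation_topology: "topspace operation_topology = operations"
  by (simp add: operation_topology_def operations_def o_def)

lemma closed_function_clone_operations: "closed_function_clone (operations :: 'a operation set)"
proof -
  have "closedin operation_topology (operations :: 'a operation set)"
    by (metis closedin_topspace topspace_operation_topology)
  moreover have "function_clone (operations :: 'a operation set)"
    unfolding function_clone_def
  proof (intro conjI ballI allI impI)
    fix n k :: nat assume "1 \<le> n" "k < n"
    then show "projection n k \<in> (operations :: 'a operation set)"
      by (simp add: operations_def projection_def)
  next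
    fix f :: "'a operation" and m and gs :: "'a operation list"
    assume f: "f \<in> operations" and gs: "length gs = arity f"
      and g: "\<forall>g\<in>set gs. g \<in> operations \<and> arity g = m"
    from f gs have "gs \<noteq> []"
      by (auto simp: operations_def)
    with g have "hd gs \<in> operations" "arity (hd gs) = m"
      by simp_all
    then have "1 \<le> m"
      by (auto simp: operations_def)
    then show "composition m f gs \<in> operations"
      by (simp add: operations_def composition_def)
  qed simp
  ultimately show ?thesis
    by (simp add: closed_function_clone_def)
qed

lemma injections_subset_Horn_clone: "injections \<subseteq> Horn_clone"
  by (auto simp: Horn_clone_def)

lemma closed_function_clone_Horn_clone: "closed_function_clone (Horn_clone :: 'a operation set)"
proof -
  let ?F = "{C :: 'a operation set. closed_function_clone C \<and> injections \<subseteq> C}"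
  have mem: "operations \<in> ?F"
    using closed_function_clone_operations by (auto simp: injections_def)
  have "closedin operation_topology (\<Inter>?F)"
    using mem by (intro closedin_Inter) (auto simp: closed_function_clone_def)
  moreover have "function_clone (\<Inter>?F)"
    unfolding function_clone_def
  proof (intro conjI ballI allI impI)
    show "\<Inter>?F \<subseteq> operations"
      using mem by blast
  next
    fix n k :: nat assume "1 \<le> n" "k < n"
    then show "projection n k \<in> \<Inter>?F"
      by (auto simp: closed_function_clone_def function_clone_def)
  next
    fix f :: "'a operation" and m and gs :: "'a operation list"
    assume f: "f \<in> \<Inter>?F" and gs: "length gs = arity f"
      and g: "\<forall>g\<in>set gs. g \<in> \<Inter>?F \<and> arity g = m"
    show "composition m f gs \<in> \<Inter>?F"
    proof
      fix C assume C: "C \<in> ?F"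
      with f g have "f \<in> C" "\<forall>g\<in>set gs. g \<in> C \<and> arity g = m"
        by (meson InterD)+
      moreover from C have "function_clone C"
        by (simp add: closed_function_clone_def)
      ultimately show "composition m f gs \<in> C"
        using gs by (simp add: function_clone_def)
    qed
  qed
  ultimately show ?thesis
    by (simp add: Horn_clone_def closed_function_clone_def)
qed

end

theory Submission
  imports Defs "HOL-Combinatorics.Permutations"
begin

text \<open>
  Let \<open>\<xi>\<close> be an isomorphism from the Horn clone onto a closed clone. The unary operations in the
  Horn clone are the injections, so \<open>\<xi>\<close> yields a faithful representation \<open>\<phi>\<close> of the monoid of
  injections of \<open>D\<close> by self-maps of \<open>D\<close>, with a closed image. The proof shows that \<open>\<phi>\<close> is a
  homeomorphism onto its image and transfers this to all arities.

  Continuity on permutations is the small index property of the symmetric group: a subgroup of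
  countable index, such as the stabilizer of a point under \<open>\<phi>\<close>, contains the pointwise
  stabilizer of a finite set (\<open>contains_pointwise_stabilizer\<close>). Permutations are dense in the
  monoid of injections, so the restriction of \<open>\<phi>\<close> to them extends continuously to all
  injections, and closedness of the image gives the extension values in that image. The
  extension has to be \<open>\<phi>\<close> itself, since an injection whose range has infinite complement is determined by the
  identities \<open>a \<circ> f = f \<circ> b\<close> that it satisfies with permutations \<open>a\<close> and \<open>b\<close>
  (\<open>limit_at_injection\<close>). Hence \<open>\<phi>\<close> is continuous (\<open>rep_continuous\<close>).

  For the inverse, take a point \<open>d\<close> that \<open>\<phi>\<close> moves and a finite set \<open>F\<close> of least size whose
  pointwise stabilizer fixes \<open>d\<close>. Minimality forces \<open>\<phi> f d\<close> to determine the set \<open>f ` F\<close>, and two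
  translates of \<open>F\<close> that meet in a single point \<open>x\<close> let one recover \<open>f x\<close> from two values of
  \<open>\<phi> f\<close> (\<open>rep_open\<close>).

  In higher arities the kernel of an operation in the Horn clone is equality on a nonempty set
  of coordinates (\<open>Horn_clone_kernel\<close>), and this set is locally constant. The operations with a
  given kernel are the compositions \<open>a \<circ> h\<close> of injections \<open>a\<close> with one surjective operation
  \<open>h\<close>, so continuity of \<open>\<xi>\<close> reduces to continuity of \<open>\<phi>\<close>. Continuity of the inverse reduces to
  the unary case by substituting permutations for the arguments.
\<close>

section \<open>Extending partial injections to permutations\<close>

lemma countable_infinite_bij_betw:
  assumes "countable A" "infinite A" "countable B" "infinite B"
  obtains f where "bij_betw f A B"
  using bij_betw_trans[OF to_nat_on_infinite[OF assms(1,2)] bij_betw_from_nat_into[OF assms(3,4)]]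
  by (rule that)

lemma obtain_parametrization:
  assumes "countable Y" "infinite Y" "infinite (UNIV :: 'b::countable set)"
  obtains e :: "'b::countable \<Rightarrow> 'a" where "inj e" "range e = Y"
proof -
  obtain e :: "'b \<Rightarrow> 'a" where "bij_betw e UNIV Y"
    using countable_infinite_bij_betw[OF countableI_type assms(3,1,2)] .
  then show ?thesis
    using that by (auto simp: bij_betw_def)
qed

lemma injection_into_moiety:
  assumes "countable (UNIV :: 'a set)" "infinite (I :: 'a set)"
  obtains t :: "'a \<Rightarrow> 'a" where "inj t" "range t \<subseteq> I" "infinite (I - range t)"
proof -
  have "infinite (UNIV :: (bool \<times> nat) set)"
    by (simp add: finite_prod)
  then obtain e :: "bool \<times> nat \<Rightarrow> 'a" where e: "inj e" "range e = I"
    using obtain_parametrization[of I] assms countable_subset[of I UNIV] by blast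
  define t where "t x = e (True, to_nat_on UNIV x)" for x :: 'a
  have "inj t"
    unfolding t_def using e(1) inj_on_to_nat_on[OF assms(1)] by (auto simp: inj_def)
  moreover have "range t \<subseteq> I"
    using e(2) by (auto simp: t_def)
  moreover have "e ` ({False} \<times> UNIV) \<subseteq> I - range t"
    using e by (auto simp: t_def inj_def)
  moreover have "infinite (e ` ({False} \<times> UNIV))"
    using e(1) by (subst finite_image_iff) (auto intro: inj_on_subset simp: finite_cartesian_product_iff)
  ultimately show ?thesis
    using that infinite_super by blast
qed

lemma extend_to_permutation:
  assumes cnt: "countable (UNIV :: 'a set)"
    and f: "bij_betw f X X'" and sub: "X \<subseteq> Y" "X' \<subseteq> Y"
    and inf: "infinite (Y - X)" "infinite (Y - X' :: 'a set)"
  obtains p where "p permutes Y" "\<And>x. x \<in> X \<Longrightarrow> p x = f x"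
proof -
  have cnt': "countable Z" for Z :: "'a set"
    using cnt by (rule countable_subset[OF subset_UNIV])
  obtain g where g: "bij_betw g (Y - X) (Y - X')"
    by (rule countable_infinite_bij_betw[OF cnt' inf(1) cnt' inf(2)])
  define p where "p x = (if x \<in> X then f x else if x \<in> Y then g x else x)" for x
  have "bij_betw p X X'"
    using f by (simp add: p_def cong: bij_betw_cong)
  moreover have "bij_betw p (Y - X) (Y - X')"
    using g by (subst bij_betw_cong[of _ p g]) (auto simp: p_def)
  ultimately have "bij_betw p (X \<union> (Y - X)) (X' \<union> (Y - X'))"
    by (intro bij_betw_combine) auto
  with sub have "bij_betw p Y Y"
    by (simp add: Un_absorb1)
  then have "p permutes Y"
    using sub by (intro bij_imp_permutes) (auto simp: p_def)
  then show ?thesis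
    using that by (simp add: p_def)
qed

lemma permutation_extending_finite_injection:
  assumes "countable (UNIV :: 'a set)" "infinite (UNIV :: 'a set)"
    and "inj (f :: 'a \<Rightarrow> 'a)" "finite (F :: 'a set)"
  obtains g where "bij g" "\<And>x. x \<in> F \<Longrightarrow> g x = f x"
proof -
  have "bij_betw f F (f ` F)"
    using assms(3) by (metis inj_on_imp_bij_betw inj_on_subset subset_UNIV)
  then obtain g where "g permutes UNIV" "\<And>x. x \<in> F \<Longrightarrow> g x = f x"
    using assms by (elim extend_to_permutation[where Y = UNIV]) auto
  then show ?thesis
    using that permutes_bij by blast
qed

text \<open>
  Let \<open>C = B - A\<close> and \<open>I = A \<inter> B\<close>. It is enough to find permutations \<open>a\<close> of \<open>A\<close> and \<open>b\<close> of \<open>B\<close>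
  such that \<open>b\<close> agrees with \<open>a \<circ> p\<close> on \<open>C\<close>: the permutation \<open>b\<inverse> \<circ> a \<circ> p\<close> then fixes \<open>C\<close> and so lives
  on \<open>A\<close>. The role of \<open>a\<close> is to push the part of \<open>p ` C\<close> that lies in \<open>A\<close> into \<open>I\<close>. There is room
  for this as soon as \<open>A\<close> contains infinitely many points outside \<open>p ` C\<close>, and the points that
  \<open>p\<close> sends from \<open>A\<close> into \<open>I\<close> supply them.
\<close>

lemma permutes_Un_generated_if_returning:
  fixes A B :: "'a set"
  assumes cnt: "countable (UNIV :: 'a set)"
    and comp: "\<And>p q. p \<in> G \<Longrightarrow> q \<in> G \<Longrightarrow> p \<circ> q \<in> G"
    and A: "\<And>p. p permutes A \<Longrightarrow> p \<in> G" and B: "\<And>p. p permutes B \<Longrightarrow> p \<in> G"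
    and p: "p permutes (A \<union> B)"
    and inf: "infinite (A \<inter> p -` (A \<inter> B))"
  shows "p \<in> G"
proof -
  define C where "C = B - A"
  have "inj p"
    using p permutes_inj by blast
  have "infinite (p ` (A \<inter> p -` (A \<inter> B)))"
    using inf finite_imageD inj_on_subset[OF \<open>inj p\<close> subset_UNIV] by blast
  moreover have "p ` (A \<inter> p -` (A \<inter> B)) \<subseteq> A \<inter> B - p ` C"
    using \<open>inj p\<close> by (auto simp: C_def inj_def)
  ultimately have "infinite (A \<inter> B - p ` C)"
    using infinite_super by blast
  then have infA: "infinite (A - (p ` C \<inter> A))" and infI: "infinite (A \<inter> B)"
    by (auto elim!: contrapos_nn intro: rev_finite_subset)
  \<comment> \<open>The points of \<open>A \<inter> B\<close> outside \<open>range t\<close> leave room to extend both \<open>a\<close> and \<open>b\<close>.\<close>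
  obtain t :: "'a \<Rightarrow> 'a" where t: "inj t" "range t \<subseteq> A \<inter> B" "infinite (A \<inter> B - range t)"
    using injection_into_moiety[OF cnt infI] .
  have "bij_betw t (p ` C \<inter> A) (t ` (p ` C \<inter> A))"
    using t(1) by (meson inj_on_imp_bij_betw inj_on_subset subset_UNIV)
  moreover have "infinite (A - t ` (p ` C \<inter> A))"
    using t(3) by (rule contrapos_nn) (auto elim!: rev_finite_subset)
  ultimately obtain a where a: "a permutes A" "\<And>x. x \<in> p ` C \<inter> A \<Longrightarrow> a x = t x"
    using extend_to_permutation[OF cnt, of t "p ` C \<inter> A" _ A] infA t(2) by blast
  have ap: "a (p x) \<in> B - (A \<inter> B - range t)" if "x \<in> C" for x
  proof (cases "p x \<in> A")
    case True
    with that a(2)[of "p x"] t(2) show ?thesis by auto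
  next
    case False
    moreover from this have "a (p x) = p x"
      using a(1) permutes_not_in by metis
    moreover have "p x \<in> A \<union> B"
      using that p permutes_in_image[OF p] by (auto simp: C_def)
    ultimately show ?thesis by auto
  qed
  have "inj (a \<circ> p)"
    using \<open>inj p\<close> a(1) permutes_inj inj_compose by blast
  then have "bij_betw (a \<circ> p) C ((a \<circ> p) ` C)"
    by (meson inj_on_imp_bij_betw inj_on_subset subset_UNIV)
  moreover have "infinite (B - C)"
    using infI by (rule contrapos_nn) (auto simp: C_def elim!: rev_finite_subset)
  moreover have "infinite (B - (a \<circ> p) ` C)"
    using t(3) by (rule contrapos_nn) (use ap in \<open>auto elim!: rev_finite_subset\<close>)
  ultimately obtain b where b: "b permutes B" "\<And>x. x \<in> C \<Longrightarrow> b x = (a \<circ> p) x"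
    using extend_to_permutation[OF cnt, of "a \<circ> p" C _ B] ap by (auto simp: C_def)
  define q where "q = inv b \<circ> (a \<circ> p)"
  have "q permutes (A \<union> B)"
    unfolding q_def using a(1) b(1) p
    by (intro permutes_compose permutes_inv) (auto elim: permutes_subset)
  moreover have "q x = x" if "x \<in> A \<union> B - A" for x
    using that permutes_inverses(2)[OF b(1), of x] b(2)[of x] by (auto simp: q_def C_def)
  ultimately have q: "q permutes A"
    by (rule permutes_superset)
  have "p = inv a \<circ> (b \<circ> q)"
    using a(1) b(1) by (auto simp: q_def fun_eq_iff permutes_inverses)
  then show ?thesis
    using comp[OF A[OF permutes_inv[OF a(1)]] comp[OF B[OF b(1)] A[OF q]]] by simp
qed

text \<open>
  Infinitely many points are mapped into \<open>A \<inter> B\<close>, so infinitely many of them come from \<open>A\<close> or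
  infinitely many come from \<open>B\<close>; the preceding lemma covers both cases by symmetry.
\<close>

lemma permutes_Un_generated:
  fixes A B :: "'a set"
  assumes cnt: "countable (UNIV :: 'a set)"
    and comp: "\<And>p q. p \<in> G \<Longrightarrow> q \<in> G \<Longrightarrow> p \<circ> q \<in> G"
    and A: "\<And>p. p permutes A \<Longrightarrow> p \<in> G" and B: "\<And>p. p permutes B \<Longrightarrow> p \<in> G"
    and inf: "infinite (A \<inter> B)" and p: "p permutes (A \<union> B)"
  shows "p \<in> G"
proof -
  have "p ` (p -` (A \<inter> B)) = A \<inter> B"
    by (rule surj_image_vimage_eq[OF permutes_surj[OF p]])
  then have "infinite (p -` (A \<inter> B))"
    using inf finite_imageI by metis
  moreover have "p -` (A \<inter> B) \<subseteq> A \<union> B"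
    using permutes_in_image[OF p] by auto
  then have "p -` (A \<inter> B) = (A \<inter> p -` (A \<inter> B)) \<union> (B \<inter> p -` (B \<inter> A))"
    by auto
  ultimately consider "infinite (A \<inter> p -` (A \<inter> B))" | "infinite (B \<inter> p -` (B \<inter> A))"
    by (metis finite_UnI)
  then show ?thesis
  proof cases
    case 1
    show ?thesis
      by (rule permutes_Un_generated_if_returning[OF cnt comp A B p 1])
  next
    case 2
    show ?thesis
      by (rule permutes_Un_generated_if_returning[OF cnt comp B A _ 2]) (use p in \<open>simp_all add: Un_commute[of B A]\<close>)
  qed
qed

section \<open>The small index property of the symmetric group\<close>

definition transport :: "('b \<Rightarrow> 'a) \<Rightarrow> ('b \<Rightarrow> 'b) \<Rightarrow> 'a \<Rightarrow> 'a" where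
  "transport e F x = (if x \<in> range e then e (F (inv e x)) else x)"

lemma transport_apply: "inj e \<Longrightarrow> transport e F (e b) = e (F b)"
  by (simp add: transport_def)

lemma transport_permutes:
  assumes "inj e" "bij F"
  shows "transport e F permutes range e"
proof (rule bij_imp_permutes)
  have "bij_betw (e \<circ> F \<circ> inv e) (range e) (range e)"
    using assms inj_imp_bij_betw_inv[of e UNIV] inj_on_imp_bij_betw[of e UNIV]
    by (auto intro!: bij_betw_trans)
  then show "bij_betw (transport e F) (range e) (range e)"
    by (rule bij_betw_cong[THEN iffD1, rotated]) (auto simp: transport_def)
qed (auto simp: transport_def)

text \<open>
  Arrange \<open>B\<close> as the columns \<open>{i} \<times> \<nat>\<close> with \<open>i \<in> \<int>\<close>, and let \<open>B'\<close> be column \<open>0\<close>. If \<open>h\<close> copies \<open>h'\<close>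
  into every column \<open>i \<ge> 0\<close> and \<open>k\<close> shifts the columns by one, then \<open>k \<circ> h \<circ> k\<inverse>\<close> is \<open>h'\<close> in every
  column \<open>i \<ge> 1\<close>. The two products cancel except in column \<open>0\<close>, so the commutator of \<open>h\<close> and
  \<open>k\<close> is \<open>h'\<close>.
\<close>

lemma commutators_cover_moiety:
  assumes "countable (UNIV :: 'a set)" "infinite (B :: 'a set)"
  obtains B' where "B' \<subseteq> B" "infinite B'" "infinite (B - B')"
    "\<And>h'. h' permutes B' \<Longrightarrow> \<exists>h k. h permutes B \<and> k permutes B \<and> h \<circ> k = h' \<circ> (k \<circ> h)"
proof -
  have "infinite (UNIV :: (int \<times> nat) set)"
    by (simp add: finite_prod)
  then obtain e :: "int \<times> nat \<Rightarrow> 'a" where e: "inj e" "range e = B"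
    using obtain_parametrization[of B] assms countable_subset[of B UNIV] by blast
  define B' where "B' = e ` ({0} \<times> UNIV)"
  have "B' \<subseteq> B"
    using e(2) by (auto simp: B'_def)
  moreover have "infinite B'"
    unfolding B'_def using e(1)
    by (subst finite_image_iff) (auto intro: inj_on_subset simp: finite_cartesian_product_iff)
  moreover have "infinite (B - B')"
  proof -
    have "e ` ({1} \<times> UNIV) \<subseteq> B - B'"
      using e by (auto simp: B'_def dest: injD)
    moreover have "infinite (e ` ({1} \<times> UNIV))"
      using e(1) by (subst finite_image_iff) (auto intro: inj_on_subset simp: finite_cartesian_product_iff)
    ultimately show ?thesis
      using infinite_super by blast
  qed
  moreover have "\<exists>h k. h permutes B \<and> k permutes B \<and> h \<circ> k = h' \<circ> (k \<circ> h)" if h': "h' permutes B'" for h'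
  proof -
    have e0: "bij_betw (\<lambda>m. e (0, m)) UNIV B'"
      using e(1) by (auto simp: bij_betw_def B'_def inj_def)
    define s where "s = the_inv_into UNIV (\<lambda>m. e (0, m)) \<circ> (h' \<circ> (\<lambda>m. e (0, m)))"
    have s: "h' (e (0, m)) = e (0, s m)" for m
      using permutes_in_image[OF h', of "e (0, m)"]
        f_the_inv_into_f_bij_betw[OF e0, of "h' (e (0, m))"] by (auto simp: s_def B'_def)
    have "bij s"
      unfolding s_def
      by (rule bij_betw_trans[OF bij_betw_trans[OF e0 permutes_imp_bij[OF h']] bij_betw_the_inv_into[OF e0]])
    define S where "S = (\<lambda>(i :: int, m). (i, if 0 \<le> i then s m else m))"
    define T where "T = (\<lambda>(i :: int, m :: nat). (i + 1, m))"
    have "bij S"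
    proof (rule bijI)
      show "inj S"
        by (rule injI) (auto simp: S_def inj_eq[OF bij_is_inj[OF \<open>bij s\<close>]] split: if_splits)
      have "(i, m) = S (i, if 0 \<le> i then inv s m else m)" for i m
        using bij_is_surj[OF \<open>bij s\<close>] by (simp add: S_def surj_f_inv_f)
      then show "surj S"
        by (metis surj_def surj_pair)
    qed
    have "bij T"
      by (rule o_bij[where g = "\<lambda>(i, m). (i - 1, m)"]) (auto simp: T_def)
    let ?h = "transport e S" and ?k = "transport e T"
    have "?h permutes B" "?k permutes B"
      using transport_permutes[OF e(1)] \<open>bij S\<close> \<open>bij T\<close> e(2) by auto
    moreover have "?h \<circ> ?k = h' \<circ> (?k \<circ> ?h)"
    proof
      fix x
      show "(?h \<circ> ?k) x = (h' \<circ> (?k \<circ> ?h)) x"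
      proof (cases "x \<in> B")
        case True
        then obtain i m where x: "x = e (i, m)"
          using e(2) by auto
        have "h' (e (i, m)) = e (i, m)" if "i \<noteq> 0" for i m
          using that e(1) by (intro permutes_not_in[OF h']) (auto simp: B'_def inj_def)
        then show ?thesis
          using s[of m] by (cases "i + 1 = 0") (auto simp: x transport_apply[OF e(1)] S_def T_def)
      next
        case False
        with \<open>B' \<subseteq> B\<close> have "h' x = x"
          using permutes_not_in[OF h'] by blast
        with False show ?thesis
          using e(2) by (simp add: transport_def)
      qed
    qed
    ultimately show ?thesis by blast
  qed
  ultimately show ?thesis
    by (rule that)
qed

text \<open>
  Countable index is expressed by a labelling \<open>coset\<close> of all permutations by natural numbers in
  which permutations with the same label lie in the same left coset of \<open>G\<close>.
\<close>

locale countable_index_subgroup =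
  fixes G :: "('a \<Rightarrow> 'a) set" and coset :: "('a \<Rightarrow> 'a) \<Rightarrow> nat"
  assumes countable_UNIV: "countable (UNIV :: 'a set)"
    and infinite_UNIV: "infinite (UNIV :: 'a set)"
    and bij: "p \<in> G \<Longrightarrow> bij p"
    and comp: "p \<in> G \<Longrightarrow> q \<in> G \<Longrightarrow> p \<circ> q \<in> G"
    and inv: "p \<in> G \<Longrightarrow> inv p \<in> G"
    and coset: "bij p \<Longrightarrow> bij q \<Longrightarrow> coset p = coset q \<Longrightarrow> inv p \<circ> q \<in> G"
begin

text \<open>
  A diagonal argument. Split \<open>Y\<close> into infinitely many infinite pieces \<open>A n\<close>. If for every \<open>n\<close>
  some permutation \<open>h n\<close> of \<open>A n\<close> had no extension to \<open>Y\<close> with label \<open>n\<close>, then the union of the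
  \<open>h n\<close> would be a permutation of \<open>Y\<close> without a label. So for some \<open>n\<close> all permutations of \<open>A n\<close>
  extend with label \<open>n\<close>, and quotients of these extensions lie in \<open>G\<close>.
\<close>

lemma full_on_subset:
  assumes "infinite (Y :: 'a set)"
  obtains A where "A \<subseteq> Y" "infinite A"
    "\<And>h. h permutes A \<Longrightarrow> \<exists>g\<in>G. g permutes Y \<and> (\<forall>x\<in>A. g x = h x)"
proof -
  have "infinite (UNIV :: (nat \<times> nat) set)"
    by (simp add: finite_prod)
  then obtain e :: "nat \<times> nat \<Rightarrow> 'a" where e: "inj e" "range e = Y"
    using obtain_parametrization[of Y] assms countable_subset[of Y UNIV] countable_UNIV by blast
  define A where "A n = e ` ({n} \<times> UNIV)" for n
  have subA: "A n \<subseteq> Y" for n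
    using e(2) by (auto simp: A_def)
  have infA: "infinite (A n)" for n
    unfolding A_def using e(1)
    by (subst finite_image_iff) (auto intro: inj_on_subset simp: finite_cartesian_product_iff)
  have "\<exists>n. \<forall>h. h permutes A n \<longrightarrow> (\<exists>p. p permutes Y \<and> coset p = n \<and> (\<forall>x\<in>A n. p x = h x))"
  proof (rule ccontr)
    assume "\<not> ?thesis"
    then obtain h where h: "\<And>n. h n permutes A n"
      and not: "\<And>n p. p permutes Y \<Longrightarrow> coset p = n \<Longrightarrow> \<exists>x\<in>A n. p x \<noteq> h n x"
      by metis
    define g where "g x = (if x \<in> Y then h (fst (inv e x)) x else x)" for x
    have g: "g x = h n x" if "x \<in> A n" for x n
      using that subA[of n] e(1) by (auto simp: g_def A_def)
    have "disjoint_family_on A UNIV"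
      using e(1) by (auto simp: disjoint_family_on_def A_def dest: injD)
    moreover have "bij_betw g (A n) (A n)" for n
      using permutes_imp_bij[OF h[of n]] g[of _ n] by (simp cong: bij_betw_cong)
    ultimately have "bij_betw g (\<Union>n. A n) (\<Union>n. A n)"
      by (intro bij_betw_UNION_disjoint) auto
    moreover have "(\<Union>n. A n) = Y"
      using e(2) by (force simp: A_def)
    ultimately have "g permutes Y"
      by (intro bij_imp_permutes) (auto simp: g_def)
    with not[of g "coset g"] g show False
      by auto
  qed
  then obtain n where n: "\<And>h. h permutes A n \<Longrightarrow> \<exists>p. p permutes Y \<and> coset p = n \<and> (\<forall>x\<in>A n. p x = h x)"
    by blast
  obtain p where p: "p permutes Y" "coset p = n" "\<And>x. x \<in> A n \<Longrightarrow> p x = x"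
    using n[OF permutes_id] by auto
  have "\<exists>g\<in>G. g permutes Y \<and> (\<forall>x\<in>A n. g x = h x)" if h: "h permutes A n" for h
  proof -
    obtain q where q: "q permutes Y" "coset q = n" "\<And>x. x \<in> A n \<Longrightarrow> q x = h x"
      using n[OF h] by auto
    have "inv p \<circ> q \<in> G"
      using p q by (intro coset) (auto dest: permutes_bij)
    moreover have "inv p \<circ> q permutes Y"
      using p(1) q(1) by (intro permutes_compose permutes_inv)
    moreover have "(inv p \<circ> q) x = h x" if "x \<in> A n" for x
      using that q(3)[of x] p(3)[of "h x"] permutes_in_image[OF h, of x] permutes_inverses(2)[OF p(1), of "h x"]
      by simp
    ultimately show ?thesis by blast
  qed
  then show ?thesis
    using that subA infA by blast
qed

text \<open>
  Two applications of the diagonal argument give \<open>B \<subseteq> A\<close> such that every permutation of \<open>A\<close> is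
  the restriction of some \<open>g \<in> G\<close>, and every permutation \<open>h\<close> of \<open>B\<close> is the restriction of some
  \<open>n \<in> G\<close> that fixes the complement of \<open>A\<close>. If \<open>g\<close> extends a permutation \<open>k\<close> of \<open>B\<close>, then \<open>g\<close> fixes
  \<open>A - B\<close>. At every point outside \<open>B\<close> one of \<open>n\<close> and \<open>g\<close> acts trivially, so the commutator of
  \<open>n\<close> and \<open>g\<close>, an element of \<open>G\<close>, is the commutator of \<open>h\<close> and \<open>k\<close>. These commutators exhaust
  the permutations of an infinite subset of \<open>B\<close>.
\<close>

lemma contains_permutations_of_moiety:
  obtains A where "infinite A" "infinite (- A)" "\<And>p. p permutes A \<Longrightarrow> p \<in> G"
proof -
  obtain A where A: "infinite A"
    "\<And>h. h permutes A \<Longrightarrow> \<exists>g\<in>G. (\<forall>x\<in>A. g x = h x)"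
    using full_on_subset[OF infinite_UNIV] by metis
  obtain B where B: "B \<subseteq> A" "infinite B"
    "\<And>h. h permutes B \<Longrightarrow> \<exists>n\<in>G. n permutes A \<and> (\<forall>x\<in>B. n x = h x)"
    using full_on_subset[OF A(1)] by metis
  obtain B' where B': "B' \<subseteq> B" "infinite B'" "infinite (B - B')"
    "\<And>h'. h' permutes B' \<Longrightarrow> \<exists>h k. h permutes B \<and> k permutes B \<and> h \<circ> k = h' \<circ> (k \<circ> h)"
    using commutators_cover_moiety[OF countable_UNIV B(2)] by metis
  have "h' \<in> G" if h': "h' permutes B'" for h'
  proof -
    obtain h k where h: "h permutes B" and k: "k permutes B" and eq: "h \<circ> k = h' \<circ> (k \<circ> h)"
      using B'(4)[OF h'] by blast
    obtain n where n: "n \<in> G" "n permutes A" "\<And>x. x \<in> B \<Longrightarrow> n x = h x"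
      using B(3)[OF h] by blast
    obtain g where g: "g \<in> G" "\<And>x. x \<in> A \<Longrightarrow> g x = k x"
      using A(2) k permutes_subset[OF _ B(1)] by metis
    have kA: "k permutes A" and h'A: "h' permutes A"
      using k h' B(1) B'(1) permutes_subset by blast+
    have gA: "g x \<in> A \<longleftrightarrow> x \<in> A" for x
    proof
      assume "g x \<in> A"
      then obtain y where "y \<in> A" "k y = g x"
        using permutes_image[OF kA] by (metis imageE)
      then show "x \<in> A"
        using g(2) bij_is_inj[OF bij[OF g(1)]] by (metis injD)
    qed (use g(2) permutes_in_image[OF kA] in auto)
    have "n \<circ> g = h' \<circ> (g \<circ> n)"
    proof
      fix x
      consider "x \<in> B" | "x \<in> A - B" | "x \<notin> A" by blast
      then show "(n \<circ> g) x = (h' \<circ> (g \<circ> n)) x"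
      proof cases
        case 1
        then have "k x \<in> B" "h x \<in> B" "x \<in> A" "h x \<in> A"
          using permutes_in_image[OF k] permutes_in_image[OF h] B(1) by auto
        with 1 fun_cong[OF eq, of x] show ?thesis
          by (simp add: n(3) g(2))
      next
        case 2
        then have "n x \<in> A"
          using permutes_in_image[OF n(2)] by auto
        moreover have "n x \<notin> B"
        proof
          assume "n x \<in> B"
          then obtain y where "y \<in> B" "h y = n x"
            using permutes_image[OF h] by (metis imageE)
          then have "x = y"
            using n(3) permutes_inj[OF n(2)] by (metis injD)
          with 2 \<open>y \<in> B\<close> show False by simp
        qed
        moreover from this have "h' (n x) = n x"
          using B'(1) permutes_not_in[OF h'] by blast
        ultimately show ?thesis
          using 2 permutes_not_in[OF k] by (simp add: g(2))
      next
        case 3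
        then show ?thesis
          using gA permutes_not_in[OF n(2)] permutes_not_in[OF h'A] by auto
      qed
    qed
    moreover have "(g \<circ> n) \<circ> inv (g \<circ> n) = id"
      using bij_is_surj[OF bij[OF comp[OF g(1) n(1)]]] by (rule surj_iff[THEN iffD1])
    ultimately have "h' = (n \<circ> g) \<circ> inv (g \<circ> n)"
      by (simp only: comp_assoc comp_id)
    then show ?thesis
      using comp inv g(1) n(1) by simp
  qed
  moreover have "infinite (- B')"
    using B'(3) by (rule contrapos_nn) (auto elim: rev_finite_subset)
  ultimately show ?thesis
    using that B'(2) by blast
qed

text \<open>
  The branches of the binary tree are uncountably many infinite sets with pairwise finite
  intersections. Move \<open>C\<close> onto each branch by a permutation; two of these permutations have the
  same label, and their quotient lies in \<open>G\<close> and moves \<open>C\<close> almost off itself.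
\<close>

lemma almost_disjoint_translate:
  assumes "infinite C" "infinite (- C)"
  obtains g where "g \<in> G" "finite (C \<inter> g ` C)" "infinite (- (C \<union> g ` C))"
proof -
  \<comment> \<open>The tree is the part of \<open>bool \<times> bool list\<close> with first component \<open>True\<close>; the other part keeps
      the union of two branches coinfinite.\<close>
  have "infinite (UNIV :: (bool \<times> bool list) set)"
    using infinite_UNIV_listI by (simp add: finite_prod)
  then obtain e :: "bool \<times> bool list \<Rightarrow> 'a" where e: "inj e"
    by (rule obtain_parametrization[OF countable_UNIV infinite_UNIV])
  define branch where "branch f = (\<lambda>n. e (True, map f [0..<n])) ` UNIV" for f
  have inf_branch: "infinite (branch f)" for f
  proof -
    have "m = n" if "e (True, map f [0..<m]) = e (True, map f [0..<n])" for m n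
      using arg_cong[OF that, of "\<lambda>x. length (snd (inv e x))"] e by simp
    then have "inj (\<lambda>n. e (True, map f [0..<n]))"
      by (rule injI)
    then show ?thesis
      unfolding branch_def by (simp add: finite_image_iff)
  qed
  have "infinite (e ` ({False} \<times> UNIV))"
    using e by (subst finite_image_iff)
      (auto intro: inj_on_subset simp: finite_cartesian_product_iff infinite_UNIV_listI)
  moreover have "e ` ({False} \<times> UNIV) \<subseteq> - (branch f \<union> branch f')" for f f'
    using e by (auto simp: branch_def inj_def)
  ultimately have inf_compl: "infinite (- (branch f \<union> branch f'))" for f f'
    using infinite_super by blast
  have cnt: "countable Z" for Z :: "'a set"
    using countable_UNIV by (rule countable_subset[OF subset_UNIV])
  have "\<exists>p. bij p \<and> p ` C = branch f" for f
  proof -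
    obtain t where t: "bij_betw t C (branch f)"
      by (rule countable_infinite_bij_betw[OF cnt assms(1) cnt inf_branch])
    obtain p where "p permutes UNIV" "\<And>x. x \<in> C \<Longrightarrow> p x = t x"
      using extend_to_permutation[OF countable_UNIV t, of UNIV] assms(2) inf_compl[of f f]
      by (auto simp: Compl_eq_Diff_UNIV)
    then show ?thesis
      using t permutes_bij by (metis bij_betw_imp_surj_on image_cong)
  qed
  then obtain p where p: "\<And>f. bij (p f)" "\<And>f. p f ` C = branch f"
    by metis
  have "\<not> inj (\<lambda>f. coset (p f))"
  proof
    assume "inj (\<lambda>f. coset (p f))"
    then obtain u where "\<And>f. u (coset (p f)) = f"
      by (metis inv_f_f)
    then have "surj (\<lambda>n. Collect (u n))"
      by (intro surjI[where f = "\<lambda>X. coset (p (\<lambda>n. n \<in> X))"]) simp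
    then show False
      using Cantors_theorem[of "UNIV :: nat set"] by auto
  qed
  then obtain f f' where ff': "f \<noteq> f'" "coset (p f) = coset (p f')"
    by (auto simp: inj_def)
  define g where "g = inv (p f) \<circ> p f'"
  have "finite (branch f \<inter> branch f')"
  proof -
    \<comment> \<open>Two branches have no common nodes below the level where they separate.\<close>
    obtain N where N: "f N \<noteq> f' N"
      using ff'(1) by blast
    have "branch f \<inter> branch f' \<subseteq> (\<lambda>n. e (True, map f [0..<n])) ` {..N}"
    proof
      fix x assume "x \<in> branch f \<inter> branch f'"
      then obtain m n where x: "x = e (True, map f [0..<m])" and "x = e (True, map f' [0..<n])"
        unfolding branch_def by blast
      then have eq: "map f [0..<m] = map f' [0..<n]"
        using e by (simp add: inj_eq)
      have "m = n"
        using arg_cong[OF eq, of length] by simp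
      have "m \<le> N"
      proof (rule ccontr)
        assume "\<not> m \<le> N"
        with arg_cong[OF eq, of "\<lambda>xs. xs ! N"] \<open>m = n\<close> N show False by simp
      qed
      with x show "x \<in> (\<lambda>n. e (True, map f [0..<n])) ` {..N}" by auto
    qed
    then show ?thesis
      using finite_surj by blast
  qed
  have gC: "g ` C = inv (p f) ` branch f'" and C: "C = inv (p f) ` branch f"
    using p(2) bij_is_inj[OF p(1)] by (auto simp: g_def image_comp simp flip: p(2))
  have inv_p: "bij (inv (p f))"
    using p(1) bij_imp_bij_inv by blast
  have "C \<inter> g ` C = inv (p f) ` (branch f \<inter> branch f')"
    using C gC image_Int[OF bij_is_inj[OF inv_p]] by metis
  moreover have "- (C \<union> g ` C) = inv (p f) ` (- (branch f \<union> branch f'))"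
    using C gC bij_image_Compl_eq[OF inv_p] image_Un by metis
  moreover have "g \<in> G"
    unfolding g_def using p(1) ff'(2) coset by blast
  moreover have "infinite (inv (p f) ` (- (branch f \<union> branch f')))"
    using inf_compl inj_on_subset[OF bij_is_inj[OF inv_p] subset_UNIV] by (subst finite_image_iff) auto
  ultimately show ?thesis
    using that[of g] \<open>finite (branch f \<inter> branch f')\<close> by simp
qed

text \<open>
  The small index property of the symmetric group, due to Dixon, Neumann and Thomas. If \<open>G\<close>
  contains all permutations of \<open>A\<close>, then it also contains all permutations of \<open>g ` A\<close> for
  \<open>g \<in> G\<close>, hence all permutations of \<open>A \<union> g ` A\<close>. With \<open>g\<close> from the preceding lemma for the
  complement of \<open>A\<close>, this union is cofinite.
\<close>

theorem contains_pointwise_stabilizer: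
  obtains F where "finite F" "\<And>p. p permutes - F \<Longrightarrow> p \<in> G"
proof -
  obtain A where A: "infinite A" "infinite (- A)" "\<And>p. p permutes A \<Longrightarrow> p \<in> G"
    using contains_permutations_of_moiety by blast
  obtain g where g: "g \<in> G" "finite (- A \<inter> g ` (- A))" "infinite (- (- A \<union> g ` (- A)))"
    using almost_disjoint_translate[of "- A"] A by auto
  have bij_g: "bij g"
    using bij g(1) by blast
  have gA: "- (g ` (- A)) = g ` A"
    using bij_image_Compl_eq[OF bij_g, of "- A"] by simp
  have B: "q \<in> G" if q: "q permutes g ` A" for q
  proof -
    have "inv g \<circ> q \<circ> g permutes A"
    proof (rule bij_imp_permutes)
      show "bij_betw (inv g \<circ> q \<circ> g) A A"
        using bij_betw_trans[OF bij_betw_trans[OF _ permutes_imp_bij[OF q]], of g A "inv g" A]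
          inj_imp_bij_betw_inv[OF bij_is_inj[OF bij_g], of A] inj_on_imp_bij_betw[of g A]
          inj_on_subset[OF bij_is_inj[OF bij_g] subset_UNIV] by (simp add: comp_assoc)
      show "(inv g \<circ> q \<circ> g) x = x" if "x \<notin> A" for x
      proof -
        have "g x \<notin> g ` A"
          using that bij_is_inj[OF bij_g] by (simp add: inj_image_mem_iff)
        then show ?thesis
          using permutes_not_in[OF q] bij_is_inj[OF bij_g] by simp
      qed
    qed
    then have "g \<circ> (inv g \<circ> q \<circ> g) \<circ> inv g \<in> G"
      using A(3) comp inv g(1) by blast
    moreover have "g \<circ> (inv g \<circ> q \<circ> g) \<circ> inv g = q"
      using bij_is_surj[OF bij_g] by (simp add: fun_eq_iff surj_f_inv_f)
    ultimately show ?thesis by simp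
  qed
  have "infinite (A \<inter> g ` A)"
    using g(3) gA by simp
  then have "p \<in> G" if "p permutes A \<union> g ` A" for p
    using permutes_Un_generated[OF countable_UNIV comp A(3) B _ that] by blast
  moreover have "A \<union> g ` A = - (- A \<inter> g ` (- A))"
    using gA by blast
  ultimately show ?thesis
    using that g(2) by metis
qed

end

section \<open>Representations of the monoid of injections\<close>

text \<open>
  The last assumption says that the image of \<open>\<phi>\<close> is closed under pointwise limits. It cannot be
  dropped: on the disjoint union of \<open>'a\<close> with \<open>{0, 1}\<close>, let permutations fix \<open>0\<close> and \<open>1\<close> while all
  other injections send both to \<open>1\<close>. This faithful action is discontinuous, because the
  permutations are dense in the injections.
\<close>

locale closed_injection_monoid_representation =
  fixes \<phi> :: "('a \<Rightarrow> 'a) \<Rightarrow> 'b \<Rightarrow> 'b"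
  assumes countable_UNIV: "countable (UNIV :: 'a set)"
    and infinite_UNIV: "infinite (UNIV :: 'a set)"
    and countable_UNIV': "countable (UNIV :: 'b set)"
    and rep_id: "\<phi> id = id"
    and rep_comp: "inj f \<Longrightarrow> inj g \<Longrightarrow> \<phi> (f \<circ> g) = \<phi> f \<circ> \<phi> g"
    and faithful: "inj f \<Longrightarrow> inj g \<Longrightarrow> \<phi> f = \<phi> g \<Longrightarrow> f = g"
    and closed_image:
      "(\<And>E. finite E \<Longrightarrow> \<exists>f. inj f \<and> (\<forall>d\<in>E. \<phi> f d = p d)) \<Longrightarrow> \<exists>f. inj f \<and> \<phi> f = p"
begin

lemma rep_comp_apply: "inj f \<Longrightarrow> inj g \<Longrightarrow> \<phi> (f \<circ> g) d = \<phi> f (\<phi> g d)"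
  by (simp add: rep_comp)

lemma rep_inv_apply:
  assumes "bij g"
  shows "\<phi> (inv g) (\<phi> g d) = d"
  using rep_comp_apply[of "inv g" g d] bij_is_inj[OF assms] bij_is_inj[OF bij_imp_bij_inv[OF assms]]
  by (simp add: rep_id)

definition supports :: "'a set \<Rightarrow> 'b \<Rightarrow> bool" where
  "supports F d \<longleftrightarrow> finite F \<and> (\<forall>g. bij g \<longrightarrow> (\<forall>x\<in>F. g x = x) \<longrightarrow> \<phi> g d = d)"

text \<open>
  The permutations fixing \<open>d\<close> form a subgroup whose cosets correspond to the points of the
  orbit of \<open>d\<close>, and this orbit is countable.
\<close>

lemma ex_support: "\<exists>F. supports F d"
proof -
  let ?G = "{g. bij g \<and> \<phi> g d = d}"
  have "countable_index_subgroup ?G (\<lambda>g. to_nat_on UNIV (\<phi> g d))"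
  proof
    fix p q :: "'a \<Rightarrow> 'a"
    show "p \<circ> q \<in> ?G" if "p \<in> ?G" "q \<in> ?G"
      using that rep_comp_apply[of p q d] by (auto intro: bij_comp dest: bij_is_inj)
    show "inv p \<in> ?G" if "p \<in> ?G"
      using that rep_inv_apply[of p d] by (auto intro: bij_imp_bij_inv)
    show "inv p \<circ> q \<in> ?G"
      if "bij p" "bij q" "to_nat_on UNIV (\<phi> p d) = to_nat_on UNIV (\<phi> q d)"
    proof -
      have "\<phi> p d = \<phi> q d"
        using that(3) inj_on_to_nat_on[OF countable_UNIV'] by (auto dest: inj_onD)
      then have "\<phi> (inv p \<circ> q) d = d"
        using that(1,2) rep_comp_apply[of "inv p" q d] rep_inv_apply[OF that(1), of d]
        by (simp add: bij_is_inj bij_imp_bij_inv)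
      then show ?thesis
        using that(1,2) by (simp add: bij_comp bij_imp_bij_inv)
    qed
  qed (use countable_UNIV infinite_UNIV in auto)
  then obtain F where F: "finite F" "\<And>p. p permutes - F \<Longrightarrow> p \<in> ?G"
    using countable_index_subgroup.contains_pointwise_stabilizer by blast
  have "\<phi> g d = d" if "bij g" "\<forall>x\<in>F. g x = x" for g
  proof -
    have "g permutes UNIV"
      using that(1) by (intro bij_imp_permutes) auto
    then have "g permutes - F"
      by (rule permutes_superset) (use that(2) in auto)
    with F(2) show ?thesis by blast
  qed
  with F(1) show ?thesis
    by (auto simp: supports_def)
qed

lemma permutations_agreeing_on_support:
  assumes "supports F d" "bij g" "bij g'" "\<And>x. x \<in> F \<Longrightarrow> g x = g' x"
  shows "\<phi> g d = \<phi> g' d"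
proof -
  have inv_g: "bij (inv g)"
    using assms(2) by (rule bij_imp_bij_inv)
  have "bij (inv g \<circ> g')"
    using assms(3) inv_g by (intro bij_comp)
  moreover have "(inv g \<circ> g') x = x" if "x \<in> F" for x
    using assms(2) assms(4)[OF that, symmetric] by (simp add: bij_is_inj)
  ultimately have "\<phi> (inv g \<circ> g') d = d"
    using assms(1) by (simp add: supports_def)
  moreover have "g \<circ> (inv g \<circ> g') = g'"
    using bij_is_surj[OF assms(2)] by (simp add: fun_eq_iff surj_f_inv_f)
  ultimately show ?thesis
    using rep_comp_apply[of g "inv g \<circ> g'" d] \<open>bij (inv g \<circ> g')\<close> assms(2) by (simp add: bij_is_inj)
qed

text \<open>
  The pair \<open>(f, p)\<close> lies in the closure of the graph of \<open>\<phi>\<close> restricted to the permutations.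
\<close>

definition limit_at :: "('a \<Rightarrow> 'a) \<Rightarrow> ('b \<Rightarrow> 'b) \<Rightarrow> bool" where
  "limit_at f p \<longleftrightarrow> (\<forall>E F. finite E \<longrightarrow> finite F \<longrightarrow>
     (\<exists>g. bij g \<and> (\<forall>x\<in>F. g x = f x) \<and> (\<forall>d\<in>E. \<phi> g d = p d)))"

lemma limit_at_permutation: "bij g \<Longrightarrow> limit_at g (\<phi> g)"
  by (auto simp: limit_at_def)

lemma limit_at_comp:
  assumes "limit_at f p" "limit_at h q"
  shows "limit_at (h \<circ> f) (q \<circ> p)"
  unfolding limit_at_def
proof (intro allI impI)
  fix E :: "'b set" and F :: "'a set" assume fin: "finite E" "finite F"
  obtain g where g: "bij g" "\<forall>x\<in>F. g x = f x" "\<forall>d\<in>E. \<phi> g d = p d"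
    using assms(1) fin unfolding limit_at_def by blast
  obtain g' where g': "bij g'" "\<forall>x\<in>f ` F. g' x = h x" "\<forall>d\<in>p ` E. \<phi> g' d = q d"
    using assms(2) finite_imageI[OF fin(1), of p] finite_imageI[OF fin(2), of f]
    unfolding limit_at_def by blast
  have "bij (g' \<circ> g)"
    using g(1) g'(1) by (rule bij_comp)
  then show "\<exists>g. bij g \<and> (\<forall>x\<in>F. g x = (h \<circ> f) x) \<and> (\<forall>d\<in>E. \<phi> g d = (q \<circ> p) d)"
    using g g' rep_comp[of g' g] by (intro exI[of _ "g' \<circ> g"]) (simp add: bij_is_inj)
qed

lemma limit_at_unique:
  assumes "limit_at f p" "limit_at f q"
  shows "p = q"
proof
  fix d
  obtain F where F: "supports F d"
    using ex_support by blast
  then have fin: "finite F" "finite {d}"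
    by (auto simp: supports_def)
  obtain g where g: "bij g" "\<forall>x\<in>F. g x = f x" "\<forall>d\<in>{d}. \<phi> g d = p d"
    using assms(1) fin unfolding limit_at_def by meson
  obtain g' where g': "bij g'" "\<forall>x\<in>F. g' x = f x" "\<forall>d\<in>{d}. \<phi> g' d = q d"
    using assms(2) fin unfolding limit_at_def by meson
  show "p d = q d"
    using permutations_agreeing_on_support[OF F g(1) g'(1)] g g' by simp
qed

text \<open>
  Near \<open>f\<close> the value \<open>\<phi> g d\<close> depends only on \<open>g\<close> being equal to \<open>f\<close> on a support of \<open>d\<close>. So the
  restriction of \<open>\<phi>\<close> to the permutations has a pointwise limit at \<open>f\<close>, and closedness of the
  image provides a preimage \<open>f'\<close> of the limit.
\<close>

lemma ex_limit_at:
  assumes "inj f"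
  obtains f' where "inj f'" "limit_at f (\<phi> f')"
proof -
  obtain S where S: "\<And>d. supports (S d) d"
    using ex_support by metis
  then have fin: "finite (S d)" for d
    by (simp add: supports_def)
  have "\<exists>g. bij g \<and> (\<forall>x\<in>S d. g x = f x)" for d
    using permutation_extending_finite_injection[OF countable_UNIV infinite_UNIV assms fin] by metis
  then obtain G where G: "\<And>d. bij (G d)" "\<And>d x. x \<in> S d \<Longrightarrow> G d x = f x"
    by metis
  define p where "p d = \<phi> (G d) d" for d
  have lim: "limit_at f p"
    unfolding limit_at_def
  proof (intro allI impI)
    fix E :: "'b set" and F :: "'a set" assume "finite E" "finite F"
    then have "finite (F \<union> (\<Union>d\<in>E. S d))"
      using fin by blast
    then obtain g where g: "bij g" "\<And>x. x \<in> F \<union> (\<Union>d\<in>E. S d) \<Longrightarrow> g x = f x"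
      using permutation_extending_finite_injection[OF countable_UNIV infinite_UNIV assms] by metis
    have "\<phi> g d = p d" if "d \<in> E" for d
      unfolding p_def
      by (rule permutations_agreeing_on_support[OF S g(1) G(1)]) (use g(2) G(2) that in auto)
    with g show "\<exists>g. bij g \<and> (\<forall>x\<in>F. g x = f x) \<and> (\<forall>d\<in>E. \<phi> g d = p d)"
      by blast
  qed
  have "\<exists>h. inj h \<and> \<phi> h = p"
  proof (rule closed_image)
    fix E :: "'b set" assume "finite E"
    with lim have "\<exists>g. bij g \<and> (\<forall>x\<in>{}. g x = f x) \<and> (\<forall>d\<in>E. \<phi> g d = p d)"
      unfolding limit_at_def by blast
    then show "\<exists>f. inj f \<and> (\<forall>d\<in>E. \<phi> f d = p d)"
      using bij_is_inj by blast
  qed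
  with lim that show ?thesis by blast
qed

text \<open>
  Every identity \<open>a \<circ> f = f \<circ> b\<close> between \<open>f\<close> and permutations is inherited by \<open>f'\<close>, because limits
  are unique and \<open>\<phi>\<close> is faithful. Transpositions outside \<open>range f\<close> show that
  \<open>range f' \<subseteq> range f\<close>, so \<open>f' = f \<circ> k\<close>. Every permutation \<open>b\<close> can be transported along \<open>f\<close> to
  some \<open>a\<close>, so \<open>k\<close> commutes with all permutations and must be the identity.
\<close>

lemma limit_at_sparse_injection:
  assumes "inj f" "infinite (- range f)" "inj f'" "limit_at f (\<phi> f')"
  shows "f' = f"
proof -
  have intertwine: "a \<circ> f' = f' \<circ> b" if "bij a" "bij b" "a \<circ> f = f \<circ> b" for a b
  proof -
    have "limit_at (a \<circ> f) (\<phi> a \<circ> \<phi> f')" "limit_at (f \<circ> b) (\<phi> f' \<circ> \<phi> b)"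
      using assms(4) that limit_at_comp limit_at_permutation by blast+
    then have "\<phi> (a \<circ> f') = \<phi> (f' \<circ> b)"
      using limit_at_unique that assms(3) by (simp add: rep_comp bij_is_inj)
    then show ?thesis
      by (intro faithful inj_compose) (use that assms(3) bij_is_inj in auto)
  qed
  have "f' x \<in> range f" for x
  proof (rule ccontr)
    assume y: "f' x \<notin> range f"
    obtain z where z: "z \<in> - range f" "z \<noteq> f' x"
      using assms(2) by (metis finite.emptyI finite.insertI finite_subset insertI1 subsetI singletonD)
    have "Transposition.transpose (f' x) z \<circ> f = f \<circ> id"
    proof
      fix u show "(Transposition.transpose (f' x) z \<circ> f) u = (f \<circ> id) u"
        using y z(1) by (simp add: Transposition.transpose_def) (metis rangeI)
    qed
    then have "Transposition.transpose (f' x) z \<circ> f' = f' \<circ> id"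
      by (intro intertwine) auto
    then have "Transposition.transpose (f' x) z (f' x) = f' x"
      by (metis comp_apply comp_id)
    with z(2) show False by simp
  qed
  then have "\<exists>y. f' x = f y" for x
    by (auto simp: image_iff)
  then obtain k where k: "\<And>x. f' x = f (k x)"
    by metis
  have commute: "k (b x) = b (k x)" if "bij b" for b x
  proof -
    define a where "a = transport f b"
    have "bij a"
      unfolding a_def using transport_permutes[OF assms(1) that] permutes_bij by blast
    moreover have "a \<circ> f = f \<circ> b"
      by (simp add: a_def fun_eq_iff transport_apply[OF assms(1)])
    ultimately have "a (f' x) = f' (b x)"
      using intertwine[OF _ that] by (metis comp_apply)
    then have "f (b (k x)) = f (k (b x))"
      by (simp add: k a_def transport_apply[OF assms(1)])
    with assms(1) show ?thesis
      by (metis injD)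
  qed
  have "k x = x" for x
  proof (rule ccontr)
    assume "k x \<noteq> x"
    obtain z where "z \<notin> {x, k x}"
      using infinite_UNIV by (metis ex_new_if_finite finite.emptyI finite.insertI)
    then show False
      using commute[of "Transposition.transpose (k x) z" x] \<open>k x \<noteq> x\<close> by (auto simp: Transposition.transpose_def)
  qed
  with k show ?thesis by auto
qed

text \<open>
  If \<open>range f\<close> has a small complement, there may be no transposition outside it. Composing with
  an injection \<open>h\<close> whose range has infinite complement makes the preceding lemma applicable, and
  \<open>h\<close> can be cancelled afterwards.
\<close>

lemma limit_at_injection:
  assumes "inj f"
  shows "limit_at f (\<phi> f)"
proof -
  obtain h :: "'a \<Rightarrow> 'a" where "inj h" "infinite (- range h)"
    using injection_into_moiety[OF countable_UNIV infinite_UNIV] by (metis Compl_eq_Diff_UNIV)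
  then have lim_h: "limit_at h (\<phi> h)"
    using limit_at_sparse_injection ex_limit_at by metis
  obtain f' where f': "inj f'" "limit_at f (\<phi> f')"
    using ex_limit_at[OF assms] .
  have "limit_at (h \<circ> f) (\<phi> (h \<circ> f'))"
    using limit_at_comp[OF f'(2) lim_h] \<open>inj h\<close> f'(1) by (simp add: rep_comp)
  moreover have "infinite (- range (h \<circ> f))"
    using \<open>infinite (- range h)\<close> by (rule contrapos_nn) (auto elim!: rev_finite_subset)
  ultimately have "h \<circ> f' = h \<circ> f"
    using limit_at_sparse_injection \<open>inj h\<close> assms f'(1) inj_compose by blast
  then have "f' = f"
    using \<open>inj h\<close> by (simp add: fun.inj_map_strong fun_eq_iff inj_eq)
  with f'(2) show ?thesis by simp
qed

text \<open>
  Both values are approximated by values at permutations that agree on \<open>F\<close>.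
\<close>

theorem rep_continuous:
  assumes "supports F d" "inj f" "inj f'" "\<And>x. x \<in> F \<Longrightarrow> f x = f' x"
  shows "\<phi> f d = \<phi> f' d"
proof -
  have fin: "finite F" "finite {d}"
    using assms(1) by (auto simp: supports_def)
  obtain g where g: "bij g" "\<forall>x\<in>F. g x = f x" "\<forall>d\<in>{d}. \<phi> g d = \<phi> f d"
    using limit_at_injection[OF assms(2)] fin unfolding limit_at_def by meson
  obtain g' where g': "bij g'" "\<forall>x\<in>F. g' x = f' x" "\<forall>d\<in>{d}. \<phi> g' d = \<phi> f' d"
    using limit_at_injection[OF assms(3)] fin unfolding limit_at_def by meson
  show ?thesis
    using permutations_agreeing_on_support[OF assms(1) g(1) g'(1)] g g' assms(4) by simp
qed

text \<open>
  The pointwise stabilizers of \<open>F\<close> and \<open>F'\<close> consist of the permutations of two cofinite sets.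
  These generate all permutations of the union, that is, the pointwise stabilizer of \<open>F \<inter> F'\<close>.
\<close>

lemma supports_Int:
  assumes "supports F d" "supports F' d"
  shows "supports (F \<inter> F') d"
proof -
  let ?G = "{g. bij g \<and> \<phi> g d = d}"
  have fin: "finite F" "finite F'"
    using assms by (auto simp: supports_def)
  have stab: "p \<in> ?G" if "supports F d" "p permutes - F" for F p
    using that permutes_bij permutes_not_in[OF that(2)] by (auto simp: supports_def)
  have "\<phi> g d = d" if "bij g" "\<forall>x\<in>F \<inter> F'. g x = x" for g
  proof -
    have "g permutes UNIV"
      using that(1) by (intro bij_imp_permutes) auto
    then have g: "g permutes - F \<union> - F'"
      by (rule permutes_superset) (use that(2) in auto)
    have "infinite (- F \<inter> - F')"
      using fin infinite_UNIV by (metis Compl_Un finite_UnI finite_compl)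
    moreover have "p \<circ> q \<in> ?G" if "p \<in> ?G" "q \<in> ?G" for p q
      using that rep_comp_apply[of p q d] by (auto intro: bij_comp dest: bij_is_inj)
    ultimately have "g \<in> ?G"
      using permutes_Un_generated[OF countable_UNIV, of ?G "- F" "- F'" g] stab assms g by blast
    then show ?thesis by simp
  qed
  with fin show ?thesis
    by (auto simp: supports_def)
qed

lemma supports_translate:
  assumes "supports F d" "bij h"
  shows "supports (h ` F) (\<phi> h d)"
  unfolding supports_def
proof (intro conjI allI impI)
  show "finite (h ` F)"
    using assms(1) by (simp add: supports_def)
  fix g :: "'a \<Rightarrow> 'a" assume g: "bij g" "\<forall>x\<in>h ` F. g x = x"
  have "\<phi> (g \<circ> h) d = \<phi> h d"
    using g by (intro permutations_agreeing_on_support[OF assms(1) bij_comp[OF assms(2) g(1)] assms(2)]) auto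
  then show "\<phi> g (\<phi> h d) = \<phi> h d"
    using g(1) assms(2) by (simp add: rep_comp bij_is_inj)
qed

text \<open>
  As \<open>\<phi>\<close> is faithful, some permutation moves some point \<open>d\<close>, so the supports of \<open>d\<close> are
  nonempty; let \<open>F\<close> be one of least size. A permutation \<open>h\<close> with \<open>\<phi> h d = d\<close> must satisfy \<open>h ` F = F\<close>, since otherwise
  \<open>F \<inter> h ` F\<close> would be a smaller support of \<open>d\<close>. So \<open>\<phi> f d\<close> determines the set \<open>f ` F\<close>, first for
  permutations and then, by continuity, for injections.
\<close>

lemma ex_minimal_support:
  obtains d F where "F \<noteq> {}" "supports F d"
    "\<And>f f'. inj f \<Longrightarrow> inj f' \<Longrightarrow> \<phi> f d = \<phi> f' d \<Longrightarrow> f ` F = f' ` F"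
proof -
  obtain x y :: 'a where "x \<noteq> y"
    using infinite_UNIV by (metis finite.simps UNIV_eq_I singletonI)
  then have "Transposition.transpose x y \<noteq> id"
    by (metis id_apply transpose_apply_first)
  moreover have "inj (Transposition.transpose x y)"
    by simp
  ultimately have "\<phi> (Transposition.transpose x y) \<noteq> id"
    using faithful[of "Transposition.transpose x y" id] rep_id by auto
  then obtain d where d: "\<phi> (Transposition.transpose x y) d \<noteq> d"
    by (auto simp: fun_eq_iff)
  define F where "F = (ARG_MIN card F. supports F d)"
  have F: "supports F d" and min: "\<And>F'. supports F' d \<Longrightarrow> card F \<le> card F'"
    using ex_support[of d] arg_min_nat_lemma[of "\<lambda>F. supports F d" _ card] unfolding F_def by blast+
  have fin: "finite F"
    using F by (simp add: supports_def)
  have "F \<noteq> {}"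
  proof
    assume "F = {}"
    with F d show False
      by (simp add: supports_def)
  qed
  moreover note F
  moreover have "f ` F = f' ` F" if inj: "inj f" "inj f'" and same: "\<phi> f d = \<phi> f' d" for f f'
  proof -
    obtain g where g: "bij g" "\<And>x. x \<in> F \<Longrightarrow> g x = f x"
      using permutation_extending_finite_injection[OF countable_UNIV infinite_UNIV inj(1) fin] by metis
    obtain g' where g': "bij g'" "\<And>x. x \<in> F \<Longrightarrow> g' x = f' x"
      using permutation_extending_finite_injection[OF countable_UNIV infinite_UNIV inj(2) fin] by metis
    have eq: "\<phi> g d = \<phi> g' d"
      using rep_continuous[OF F inj(1) bij_is_inj[OF g(1)]] rep_continuous[OF F inj(2) bij_is_inj[OF g'(1)]]
        g(2) g'(2) same by simp
    have inv_g: "bij (inv g)"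
      using g(1) by (rule bij_imp_bij_inv)
    define h where "h = inv g \<circ> g'"
    have "bij h"
      unfolding h_def using g'(1) inv_g by (rule bij_comp)
    have "\<phi> h d = d"
      unfolding h_def using rep_comp_apply[of "inv g" g' d] rep_inv_apply[OF g(1), of d] eq inv_g g'(1)
      by (simp add: bij_is_inj)
    then have "supports (F \<inter> h ` F) d"
      using supports_Int[OF F] supports_translate[OF F \<open>bij h\<close>] by simp
    then have "card F \<le> card (F \<inter> h ` F)"
      by (rule min)
    then have "F \<inter> h ` F = F"
      using fin by (intro card_seteq) auto
    then have "F \<subseteq> h ` F" by blast
    moreover have "card (h ` F) = card F"
      using \<open>bij h\<close> by (intro card_image inj_on_subset[OF bij_is_inj]) auto
    ultimately have "h ` F = F"
      using fin by (metis card_subset_eq finite_imageI)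
    then have "g ` F = g ` (h ` F)" by simp
    also have "\<dots> = g' ` F"
      using bij_is_surj[OF g(1)] by (simp add: h_def image_image surj_f_inv_f)
    finally show ?thesis
      using g(2) g'(2) by (metis image_cong)
  qed
  ultimately show ?thesis
    by (rule that)
qed

text \<open>
  Two translates of the minimal support \<open>F\<close> by permutations can be made to meet in \<open>x\<close> only.
  The values of \<open>\<phi> f\<close> at the corresponding two translates of \<open>d\<close> determine the images of both
  sets under \<open>f\<close>, and the intersection of these images is \<open>{f x}\<close>.
\<close>

theorem rep_open:
  obtains E where "finite E"
    "\<And>f f'. inj f \<Longrightarrow> inj f' \<Longrightarrow> (\<And>d. d \<in> E \<Longrightarrow> \<phi> f d = \<phi> f' d) \<Longrightarrow> f x = f' x"
proof -
  obtain d F where F: "F \<noteq> {}" "supports F d"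
    "\<And>f f'. inj f \<Longrightarrow> inj f' \<Longrightarrow> \<phi> f d = \<phi> f' d \<Longrightarrow> f ` F = f' ` F"
    using ex_minimal_support by metis
  have fin: "finite F"
    using F(2) by (simp add: supports_def)
  obtain y where y: "y \<in> F"
    using F(1) by blast
  define h where "h = Transposition.transpose y x"
  have "bij h" and "h y = x"
    by (simp_all add: h_def)
  with y have h: "bij h" "x \<in> h ` F"
    by auto
  obtain Z where Z: "finite Z" "card Z = card F - 1" "Z \<subseteq> - (h ` F)"
    using infinite_arbitrarily_large[of "- (h ` F)" "card F - 1"] fin infinite_UNIV
    by (metis finite_compl finite_imageI)
  have "card (F - {y}) = card Z"
    using y fin Z(2) by simp
  then obtain b where b: "bij_betw b (F - {y}) Z"
    using fin Z(1) by (metis finite_Diff finite_same_card_bij)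
  define t where "t = b(y := x)"
  have "inj_on t F"
    using b Z(3) h(2) by (auto simp: t_def bij_betw_def inj_on_def)
  then have t: "bij_betw t F (t ` F)"
    by (rule inj_on_imp_bij_betw)
  obtain h' where h': "h' permutes UNIV" "\<And>z. z \<in> F \<Longrightarrow> h' z = t z"
    by (rule extend_to_permutation[OF countable_UNIV t, of UNIV])
      (use fin infinite_UNIV in \<open>auto simp: finite_Diff2\<close>)
  have bij_h': "bij h'"
    using h'(1) permutes_bij by blast
  have "h' ` F = insert x Z"
  proof -
    have "h' ` F = t ` (insert y (F - {y}))"
      using h'(2) y by (simp add: insert_absorb)
    also have "\<dots> = insert x (b ` (F - {y}))"
      by (auto simp: t_def)
    finally show ?thesis
      using b by (simp add: bij_betw_def)
  qed
  then have Int: "h ` F \<inter> h' ` F = {x}"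
    using h(2) Z(3) by auto
  have image_eq: "f ` k ` F = f' ` k ` F"
    if "inj f" "inj f'" "bij k" "\<phi> f (\<phi> k d) = \<phi> f' (\<phi> k d)" for f f' k
    using F(3)[of "f \<circ> k" "f' \<circ> k"] that by (simp add: rep_comp bij_is_inj inj_compose image_comp)
  have "f x = f' x"
    if "inj f" "inj f'" and eq: "\<And>e. e \<in> {\<phi> h d, \<phi> h' d} \<Longrightarrow> \<phi> f e = \<phi> f' e" for f f'
  proof -
    have "f ` {x} = f ` h ` F \<inter> f ` h' ` F"
      using image_Int[OF that(1)] Int by metis
    also have "\<dots> = f' ` h ` F \<inter> f' ` h' ` F"
      using image_eq[OF that(1,2) h(1)] image_eq[OF that(1,2) bij_h'] eq by simp
    also have "\<dots> = f' ` {x}"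
      using image_Int[OF that(2)] Int by metis
    finally show ?thesis by simp
  qed
  then show ?thesis
    using that[of "{\<phi> h d, \<phi> h' d}"] by blast
qed

end

section \<open>The topology of pointwise convergence\<close>

lemma openin_product_discrete_iff:
  "openin (product_topology (\<lambda>_. discrete_topology UNIV) I) S \<longleftrightarrow>
     S \<subseteq> I \<rightarrow>\<^sub>E UNIV \<and>
     (\<forall>x\<in>S. \<exists>E. finite E \<and> E \<subseteq> I \<and> (\<forall>y\<in>I \<rightarrow>\<^sub>E UNIV. (\<forall>i\<in>E. y i = x i) \<longrightarrow> y \<in> S))"
    (is "?L \<longleftrightarrow> ?R")
proof
  assume L: ?L
  have "\<exists>E. finite E \<and> E \<subseteq> I \<and> (\<forall>y\<in>I \<rightarrow>\<^sub>E UNIV. (\<forall>i\<in>E. y i = x i) \<longrightarrow> y \<in> S)" if x: "x \<in> S" for x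
  proof -
    obtain V where "finite {i \<in> I. V i \<noteq> topspace (discrete_topology UNIV)}"
        and V: "x \<in> Pi\<^sub>E I V" "Pi\<^sub>E I V \<subseteq> S"
      using L[unfolded openin_product_topology_alt, rule_format, OF x] by (elim exE conjE)
    then have fin: "finite {i \<in> I. V i \<noteq> UNIV}"
      by simp
    have "y \<in> S" if "y \<in> I \<rightarrow>\<^sub>E UNIV" "\<forall>i\<in>{i \<in> I. V i \<noteq> UNIV}. y i = x i" for y
    proof -
      have "y \<in> Pi\<^sub>E I V"
      proof (rule PiE_I)
        show "y i \<in> V i" if "i \<in> I" for i
          using that \<open>\<forall>i\<in>{i \<in> I. V i \<noteq> UNIV}. y i = x i\<close> V(1) by (cases "V i = UNIV") auto
        show "y i = undefined" if "i \<notin> I" for i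
          using that \<open>y \<in> I \<rightarrow>\<^sub>E UNIV\<close> by auto
      qed
      with V(2) show ?thesis by blast
    qed
    with fin show ?thesis
      by (intro exI[of _ "{i \<in> I. V i \<noteq> UNIV}"]) auto
  qed
  with openin_subset[OF L] show ?R by simp
next
  assume R: ?R
  show ?L
    unfolding openin_product_topology_alt
  proof
    fix x assume "x \<in> S"
    then obtain E where E: "finite E" "E \<subseteq> I" "\<And>y. y \<in> I \<rightarrow>\<^sub>E UNIV \<Longrightarrow> \<forall>i\<in>E. y i = x i \<Longrightarrow> y \<in> S"
      using R by metis
    let ?V = "\<lambda>i. if i \<in> E then {x i} else UNIV"
    have "{i \<in> I. ?V i \<noteq> UNIV} \<subseteq> E" by auto
    then have "finite {i \<in> I. ?V i \<noteq> UNIV}"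
      using E(1) finite_subset by blast
    moreover have "x \<in> Pi\<^sub>E I ?V"
      using R \<open>x \<in> S\<close> by (auto simp: PiE_iff)
    moreover have "Pi\<^sub>E I ?V \<subseteq> S"
    proof
      fix y assume "y \<in> Pi\<^sub>E I ?V"
      then show "y \<in> S"
        using E(2) by (intro E(3)) (auto simp: PiE_iff split: if_splits)
    qed
    ultimately show "\<exists>U. finite {i \<in> I. U i \<noteq> topspace (discrete_topology UNIV)} \<and>
        (\<forall>i\<in>I. openin (discrete_topology UNIV) (U i)) \<and> x \<in> Pi\<^sub>E I U \<and> Pi\<^sub>E I U \<subseteq> S"
      by (intro exI[of _ ?V]) simp
  qed
qed

definition agree_on :: "'a list set \<Rightarrow> 'a operation \<Rightarrow> 'a operation \<Rightarrow> bool" where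
  "agree_on E f g \<longleftrightarrow> arity f = arity g \<and> (\<forall>t\<in>E. fun_of f t = fun_of g t)"

lemma openin_operation_topology_iff:
  "openin operation_topology U \<longleftrightarrow> U \<subseteq> operations \<and>
     (\<forall>f\<in>U. \<exists>E. finite E \<and> E \<subseteq> tuples (arity f) \<and> (\<forall>g\<in>operations. agree_on E g f \<longrightarrow> g \<in> U))"
    (is "_ \<longleftrightarrow> _ \<and> (\<forall>f\<in>U. ?nbhd f)")
proof -
  have "openin operation_topology U \<longleftrightarrow> U \<subseteq> operations \<and>
      (\<forall>n\<in>{1..}. openin (product_topology (\<lambda>_. discrete_topology UNIV) (tuples n)) {x. (n, x) \<in> U})"
    unfolding operation_topology_def openin_sum_topology by (simp add: operations_def o_def)
  also have "\<dots> \<longleftrightarrow> U \<subseteq> operations \<and> (\<forall>n\<in>{1..}. \<forall>x. (n, x) \<in> U \<longrightarrow> ?nbhd (n, x))"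
  proof (intro conj_cong refl ball_cong)
    fix n :: nat assume U: "U \<subseteq> operations" and n: "n \<in> {1..}"
    have "{x. (n, x) \<in> U} \<subseteq> tuples n \<rightarrow>\<^sub>E UNIV"
      using U by (auto simp: operations_def)
    moreover have "(\<forall>y\<in>tuples n \<rightarrow>\<^sub>E UNIV. (\<forall>i\<in>E. y i = x i) \<longrightarrow> y \<in> {x. (n, x) \<in> U}) \<longleftrightarrow>
        (\<forall>g\<in>operations. agree_on E g (n, x) \<longrightarrow> g \<in> U)" for x E
      using n by (auto simp: operations_def agree_on_def)
    ultimately show "openin (product_topology (\<lambda>_. discrete_topology UNIV) (tuples n)) {x. (n, x) \<in> U} \<longleftrightarrow>
        (\<forall>x. (n, x) \<in> U \<longrightarrow> ?nbhd (n, x))"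
      unfolding openin_product_discrete_iff by simp
  qed
  also have "\<dots> \<longleftrightarrow> U \<subseteq> operations \<and> (\<forall>f\<in>U. ?nbhd f)"
  proof (intro conj_cong refl iffI)
    assume U: "U \<subseteq> operations" and *: "\<forall>n\<in>{1..}. \<forall>x. (n, x) \<in> U \<longrightarrow> ?nbhd (n, x)"
    show "\<forall>f\<in>U. ?nbhd f"
    proof
      fix f assume "f \<in> U"
      with U have "arity f \<in> {1..}"
        by (auto simp: operations_def)
      from *[rule_format, OF this, of "fun_of f"] \<open>f \<in> U\<close> show "?nbhd f" by simp
    qed
  next
    assume *: "\<forall>f\<in>U. ?nbhd f"
    show "\<forall>n\<in>{1..}. \<forall>x. (n, x) \<in> U \<longrightarrow> ?nbhd (n, x)"
      by (intro ballI allI impI) (rule *[rule_format])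
  qed
  finally show ?thesis .
qed

lemma openin_subclone_topology_iff:
  assumes "C \<subseteq> operations"
  shows "openin (subtopology operation_topology C) U \<longleftrightarrow> U \<subseteq> C \<and>
     (\<forall>f\<in>U. \<exists>E. finite E \<and> E \<subseteq> tuples (arity f) \<and> (\<forall>g\<in>C. agree_on E g f \<longrightarrow> g \<in> U))"
    (is "?L \<longleftrightarrow> ?R")
proof
  assume ?L
  then obtain T where T: "openin operation_topology T" "U = T \<inter> C"
    by (auto simp: openin_subtopology)
  then show ?R
    using assms unfolding openin_operation_topology_iff by (metis IntD1 IntI inf.cobounded2 subsetD)
next
  assume R: ?R
  then obtain E where E: "\<And>f. f \<in> U \<Longrightarrow> finite (E f)" "\<And>f. f \<in> U \<Longrightarrow> E f \<subseteq> tuples (arity f)"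
    "\<And>f g. f \<in> U \<Longrightarrow> g \<in> C \<Longrightarrow> agree_on (E f) g f \<Longrightarrow> g \<in> U"
    by metis
  define T where "T = {g \<in> operations. \<exists>f\<in>U. agree_on (E f) g f}"
  have "openin operation_topology T"
    unfolding openin_operation_topology_iff
  proof (intro conjI ballI)
    fix g assume "g \<in> T"
    then obtain f where f: "f \<in> U" "agree_on (E f) g f"
      by (auto simp: T_def)
    have "g' \<in> T" if "g' \<in> operations" "agree_on (E f) g' g" for g'
    proof -
      have "agree_on (E f) g' f"
        using that(2) f(2) by (simp add: agree_on_def)
      with that(1) f(1) show ?thesis
        by (auto simp: T_def)
    qed
    moreover have "E f \<subseteq> tuples (arity g)"
      using E(2)[OF f(1)] f(2) by (simp add: agree_on_def)
    ultimately show "\<exists>E. finite E \<and> E \<subseteq> tuples (arity g) \<and> (\<forall>g'\<in>operations. agree_on E g' g \<longrightarrow> g' \<in> T)"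
      using E(1)[OF f(1)] by blast
  qed (auto simp: T_def)
  moreover have "U = T \<inter> C"
    using R E(3) assms by (auto simp: T_def agree_on_def)
  ultimately show ?L
    by (auto simp: openin_subtopology)
qed

lemma closedin_operation_topologyD:
  assumes "closedin operation_topology C" "p \<in> operations"
    and "\<And>E. finite E \<Longrightarrow> E \<subseteq> tuples (arity p) \<Longrightarrow> \<exists>g\<in>C. agree_on E g p"
  shows "p \<in> C"
proof (rule ccontr)
  assume "p \<notin> C"
  with assms(2) have p: "p \<in> operations - C" by blast
  have "openin operation_topology (operations - C)"
    using assms(1) by (simp add: closedin_def topspace_operation_topology)
  then obtain E where "finite E" "E \<subseteq> tuples (arity p)"
    "\<And>g. g \<in> operations \<Longrightarrow> agree_on E g p \<Longrightarrow> g \<in> operations - C"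
    using p unfolding openin_operation_topology_iff by meson
  moreover have "C \<subseteq> operations"
    using assms(1) closedin_subset topspace_operation_topology by blast
  ultimately show False
    using assms(3) by blast
qed

lemma continuous_map_operations:
  assumes sub: "C \<subseteq> operations" "C' \<subseteq> operations"
    and \<xi>: "\<xi> \<in> C \<rightarrow> C'" "\<And>f. f \<in> C \<Longrightarrow> arity (\<xi> f) = arity f"
    and pointwise: "\<And>f t. f \<in> C \<Longrightarrow> t \<in> tuples (arity f) \<Longrightarrow> \<exists>E. finite E \<and> E \<subseteq> tuples (arity f) \<and>
      (\<forall>g\<in>C. agree_on E g f \<longrightarrow> fun_of (\<xi> g) t = fun_of (\<xi> f) t)"
  shows "continuous_map (subtopology operation_topology C) (subtopology operation_topology C') \<xi>"
proof -
  have top: "topspace (subtopology operation_topology C) = C" if "C \<subseteq> operations" for C :: "'c operation set"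
    using that by (auto simp: topspace_operation_topology)
  have "openin (subtopology operation_topology C) {f \<in> C. \<xi> f \<in> U}"
    if U: "openin (subtopology operation_topology C') U" for U
    unfolding openin_subclone_topology_iff[OF sub(1)]
  proof (intro conjI ballI)
    fix f assume "f \<in> {f \<in> C. \<xi> f \<in> U}"
    then have f: "f \<in> C" "\<xi> f \<in> U" by auto
    obtain E' where E': "finite E'" "E' \<subseteq> tuples (arity f)"
      "\<And>g. g \<in> C' \<Longrightarrow> agree_on E' g (\<xi> f) \<Longrightarrow> g \<in> U"
      using U f \<xi>(2) unfolding openin_subclone_topology_iff[OF sub(2)] by metis
    have "\<forall>t\<in>E'. \<exists>E. finite E \<and> E \<subseteq> tuples (arity f) \<and>
        (\<forall>g\<in>C. agree_on E g f \<longrightarrow> fun_of (\<xi> g) t = fun_of (\<xi> f) t)"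
      using pointwise[OF f(1)] E'(2) by blast
    then obtain E where E: "\<And>t. t \<in> E' \<Longrightarrow> finite (E t)" "\<And>t. t \<in> E' \<Longrightarrow> E t \<subseteq> tuples (arity f)"
      "\<And>t g. t \<in> E' \<Longrightarrow> g \<in> C \<Longrightarrow> agree_on (E t) g f \<Longrightarrow> fun_of (\<xi> g) t = fun_of (\<xi> f) t"
      by metis
    have "g \<in> {f \<in> C. \<xi> f \<in> U}" if "g \<in> C" "agree_on (\<Union>t\<in>E'. E t) g f" for g
    proof -
      have "agree_on E' (\<xi> g) (\<xi> f)"
        using that f(1) \<xi>(2) E(3)[OF _ that(1)] by (auto simp: agree_on_def)
      moreover have "\<xi> g \<in> C'"
        using \<xi>(1) that(1) by blast
      ultimately show ?thesis
        using E'(3) that(1) by blast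
    qed
    moreover have "finite (\<Union>t\<in>E'. E t)"
      by (rule finite_UN_I[OF E'(1) E(1)])
    moreover have "(\<Union>t\<in>E'. E t) \<subseteq> tuples (arity f)"
      by (rule UN_least[OF E(2)])
    ultimately show "\<exists>E. finite E \<and> E \<subseteq> tuples (arity f) \<and> (\<forall>g\<in>C. agree_on E g f \<longrightarrow> g \<in> {f \<in> C. \<xi> f \<in> U})"
      by blast
  qed auto
  then show ?thesis
    using \<xi>(1) unfolding continuous_map_def top[OF sub(1)] top[OF sub(2)] by blast
qed

lemma homeomorphic_map_operations:
  fixes C :: "'a operation set" and C' :: "'b operation set"
  assumes sub: "C \<subseteq> operations" "C' \<subseteq> operations"
    and \<xi>: "bij_betw \<xi> C C'" "\<And>f. f \<in> C \<Longrightarrow> arity (\<xi> f) = arity f"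
    and cont: "\<And>f t. f \<in> C \<Longrightarrow> t \<in> tuples (arity f) \<Longrightarrow> \<exists>E. finite E \<and> E \<subseteq> tuples (arity f) \<and>
      (\<forall>g\<in>C. agree_on E g f \<longrightarrow> fun_of (\<xi> g) t = fun_of (\<xi> f) t)"
    and cont': "\<And>f t. f \<in> C \<Longrightarrow> t \<in> tuples (arity f) \<Longrightarrow> \<exists>E. finite E \<and> E \<subseteq> tuples (arity f) \<and>
      (\<forall>g\<in>C. agree_on E (\<xi> g) (\<xi> f) \<longrightarrow> fun_of g t = fun_of f t)"
  shows "homeomorphic_map (subtopology operation_topology C) (subtopology operation_topology C') \<xi>"
proof -
  let ?\<zeta> = "inv_into C \<xi>"
  have inv: "\<And>f. f \<in> C \<Longrightarrow> ?\<zeta> (\<xi> f) = f" "\<And>f. f \<in> C' \<Longrightarrow> \<xi> (?\<zeta> f) = f" "\<And>f. f \<in> C' \<Longrightarrow> ?\<zeta> f \<in> C"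
    using \<xi>(1) by (auto simp: bij_betw_inv_into_left bij_betw_inv_into_right bij_betw_def inv_into_into)
  have arity': "arity (?\<zeta> f) = arity f" if "f \<in> C'" for f
    using \<xi>(2)[of "?\<zeta> f"] inv(2,3) that by simp
  have "continuous_map (subtopology operation_topology C) (subtopology operation_topology C') \<xi>"
    using \<xi> cont by (intro continuous_map_operations sub) (auto simp: bij_betw_def)
  moreover have "continuous_map (subtopology operation_topology C') (subtopology operation_topology C) ?\<zeta>"
  proof (rule continuous_map_operations[OF sub(2,1)])
    fix f :: "'b operation" and t :: "'a list" assume f: "f \<in> C'" "t \<in> tuples (arity f)"
    obtain E where E: "finite E" "E \<subseteq> tuples (arity (?\<zeta> f))"
      "\<And>g. g \<in> C \<Longrightarrow> agree_on E (\<xi> g) (\<xi> (?\<zeta> f)) \<Longrightarrow> fun_of g t = fun_of (?\<zeta> f) t"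
      using cont'[of "?\<zeta> f" t] f inv(3) arity' by metis
    then show "\<exists>E. finite E \<and> E \<subseteq> tuples (arity f) \<and>
        (\<forall>g\<in>C'. agree_on E g f \<longrightarrow> fun_of (?\<zeta> g) t = fun_of (?\<zeta> f) t)"
      using f(1) inv(2,3) arity' by (intro exI[of _ E]) auto
  qed (use inv(3) arity' in auto)
  ultimately have "homeomorphic_maps (subtopology operation_topology C) (subtopology operation_topology C') \<xi> ?\<zeta>"
    using inv by (simp add: homeomorphic_maps_def)
  then show ?thesis
    by (auto simp: homeomorphic_map_maps)
qed

section \<open>Operations in the Horn clone\<close>

lemma operation_eqI:
  assumes "f \<in> operations" "g \<in> operations" "arity f = arity g"
    and "\<And>xs. xs \<in> tuples (arity g) \<Longrightarrow> fun_of f xs = fun_of g xs"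
  shows "f = g"
proof (rule prod_eqI)
  have "fun_of f \<in> tuples (arity g) \<rightarrow>\<^sub>E UNIV" "fun_of g \<in> tuples (arity g) \<rightarrow>\<^sub>E UNIV"
    using assms(1-3) by (auto simp: operations_def)
  then show "fun_of f = fun_of g"
    using assms(4) by (rule PiE_ext)
qed (use assms in simp)

definition kernel_on :: "nat set \<Rightarrow> 'a operation \<Rightarrow> bool" where
  "kernel_on J f \<longleftrightarrow> J \<noteq> {} \<and> J \<subseteq> {..<arity f} \<and>
     (\<forall>xs\<in>tuples (arity f). \<forall>ys\<in>tuples (arity f).
        fun_of f xs = fun_of f ys \<longleftrightarrow> (\<forall>j\<in>J. xs ! j = ys ! j))"

text \<open>
  These operations form a closed clone containing the injections, which bounds the Horn clone
  from above.
\<close>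

definition coordinate_kernel_operations :: "'a operation set" where
  "coordinate_kernel_operations = {f \<in> operations. \<exists>J. kernel_on J f}"

lemma composition_in_operations:
  assumes "f \<in> operations" "length gs = arity f" "\<forall>g\<in>set gs. g \<in> operations \<and> arity g = m"
  shows "composition m f gs \<in> operations"
  using closed_function_clone_operations assms
  unfolding closed_function_clone_def function_clone_def by blast

lemma kernel_on_composition:
  assumes f: "kernel_on J f" and gs: "length gs = arity f"
    and K: "\<And>g. g \<in> set gs \<Longrightarrow> arity g = m \<and> kernel_on (K g) g"
  shows "kernel_on (\<Union>j\<in>J. K (gs ! j)) (composition m f gs)"
proof -
  have J: "J \<noteq> {}" "\<And>j. j \<in> J \<Longrightarrow> j < length gs"
    using f gs by (auto simp: kernel_on_def)
  then have K': "\<And>j. j \<in> J \<Longrightarrow> arity (gs ! j) = m \<and> kernel_on (K (gs ! j)) (gs ! j)"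
    using K by simp
  have "(\<Union>j\<in>J. K (gs ! j)) \<noteq> {}" "(\<Union>j\<in>J. K (gs ! j)) \<subseteq> {..<m}"
    using J(1) K' by (fastforce simp: kernel_on_def)+
  moreover have "fun_of (composition m f gs) xs = fun_of (composition m f gs) ys \<longleftrightarrow>
      (\<forall>i\<in>(\<Union>j\<in>J. K (gs ! j)). xs ! i = ys ! i)"
    if "xs \<in> tuples m" "ys \<in> tuples m" for xs ys
  proof -
    have "fun_of (composition m f gs) xs = fun_of (composition m f gs) ys \<longleftrightarrow>
        (\<forall>j\<in>J. fun_of (gs ! j) xs = fun_of (gs ! j) ys)"
      using f gs J(2) that by (simp add: composition_def kernel_on_def tuples_def)
    also have "\<dots> \<longleftrightarrow> (\<forall>j\<in>J. \<forall>i\<in>K (gs ! j). xs ! i = ys ! i)"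
      using K' that by (intro ball_cong refl) (simp add: kernel_on_def)
    finally show ?thesis by auto
  qed
  ultimately show ?thesis
    by (simp add: kernel_on_def composition_def)
qed

text \<open>
  For fixed arity there are only finitely many candidates \<open>J\<close>. An operation outside the set
  violates each of them at some pair of tuples, and these finitely many tuples describe a
  neighbourhood in which all candidates remain violated.
\<close>

lemma closedin_coordinate_kernel_operations:
  "closedin operation_topology (coordinate_kernel_operations :: 'a operation set)"
proof -
  let ?K = "coordinate_kernel_operations :: 'a operation set"
  have "\<exists>E. finite E \<and> E \<subseteq> tuples (arity f) \<and> (\<forall>g\<in>operations. agree_on E g f \<longrightarrow> g \<in> operations - ?K)"
    if "f \<in> operations - ?K" for f :: "'a operation"
  proof -
    let ?n = "arity f"
    let ?Js = "Pow {..<?n} - {{}}"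
    have "\<exists>xs ys. xs \<in> tuples ?n \<and> ys \<in> tuples ?n \<and>
        (fun_of f xs = fun_of f ys) \<noteq> (\<forall>j\<in>J. xs ! j = ys ! j)" if "J \<in> ?Js" for J
    proof -
      have "\<not> kernel_on J f"
        using \<open>f \<in> operations - ?K\<close> by (simp add: coordinate_kernel_operations_def)
      with that show ?thesis
        unfolding kernel_on_def by blast
    qed
    then obtain X Y where XY: "\<And>J. J \<in> ?Js \<Longrightarrow> X J \<in> tuples ?n \<and> Y J \<in> tuples ?n \<and>
        (fun_of f (X J) = fun_of f (Y J)) \<noteq> (\<forall>j\<in>J. X J ! j = Y J ! j)"
      by metis
    have "g \<notin> ?K" if "agree_on (X ` ?Js \<union> Y ` ?Js) g f" for g
    proof
      assume "g \<in> ?K"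
      then obtain J where J: "kernel_on J g"
        by (auto simp: coordinate_kernel_operations_def)
      moreover have "arity g = ?n"
        using that by (simp add: agree_on_def)
      ultimately have "J \<in> ?Js"
        by (auto simp: kernel_on_def)
      then have "fun_of g (X J) = fun_of f (X J)" "fun_of g (Y J) = fun_of f (Y J)"
        using that unfolding agree_on_def by blast+
      with XY[OF \<open>J \<in> ?Js\<close>] J \<open>arity g = ?n\<close> show False
        unfolding kernel_on_def by metis
    qed
    then show ?thesis
      using XY by (intro exI[of _ "X ` ?Js \<union> Y ` ?Js"]) auto
  qed
  then have "openin operation_topology (operations - ?K)"
    unfolding openin_operation_topology_iff by blast
  then show ?thesis
    by (auto simp: closedin_def topspace_operation_topology coordinate_kernel_operations_def)
qed

lemma closed_function_clone_coordinate_kernel_operations: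
  "closed_function_clone (coordinate_kernel_operations :: 'a operation set)"
proof -
  let ?K = "coordinate_kernel_operations :: 'a operation set"
  have "function_clone ?K"
    unfolding function_clone_def
  proof (intro conjI ballI allI impI)
    show "?K \<subseteq> operations"
      by (auto simp: coordinate_kernel_operations_def)
    show "projection n k \<in> ?K" if "1 \<le> n" "k < n" for n k
    proof -
      have "kernel_on {k} (projection n k :: 'a operation)"
        using that by (simp add: kernel_on_def projection_def)
      moreover have "projection n k \<in> (operations :: 'a operation set)"
        using that by (simp add: operations_def projection_def)
      ultimately show ?thesis
        by (auto simp: coordinate_kernel_operations_def)
    qed
    show "composition m f gs \<in> ?K"
      if f: "f \<in> ?K" and gs: "length gs = arity f" "\<forall>g\<in>set gs. g \<in> ?K \<and> arity g = m" for f m gs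
    proof -
      obtain J where "kernel_on J f"
        using f by (auto simp: coordinate_kernel_operations_def)
      moreover have "\<forall>g\<in>set gs. \<exists>J. kernel_on J g"
        using gs(2) by (auto simp: coordinate_kernel_operations_def)
      then obtain K where "\<And>g. g \<in> set gs \<Longrightarrow> kernel_on (K g) g"
        by metis
      ultimately have "kernel_on (\<Union>j\<in>J. K (gs ! j)) (composition m f gs)"
        using gs by (intro kernel_on_composition) auto
      moreover have "composition m f gs \<in> operations"
        using f gs by (intro composition_in_operations) (auto simp: coordinate_kernel_operations_def)
      ultimately show ?thesis
        by (auto simp: coordinate_kernel_operations_def)
    qed
  qed
  then show ?thesis
    using closedin_coordinate_kernel_operations by (simp add: closed_function_clone_def)
qed

lemma Horn_clone_kernel:
  assumes "f \<in> Horn_clone"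
  obtains J where "kernel_on J f"
proof -
  have "kernel_on {..<arity g} g" if "g \<in> injections" for g :: "'a operation"
  proof -
    have g: "g \<in> operations" "inj_on (fun_of g) (tuples (arity g))"
      using that by (auto simp: injections_def)
    then have "0 < arity g"
      by (auto simp: operations_def)
    moreover have "fun_of g xs = fun_of g ys \<longleftrightarrow> (\<forall>j\<in>{..<arity g}. xs ! j = ys ! j)"
      if "xs \<in> tuples (arity g)" "ys \<in> tuples (arity g)" for xs ys
      using that inj_on_eq_iff[OF g(2) that] by (auto simp: tuples_def list_eq_iff_nth_eq)
    ultimately show ?thesis
      by (simp add: kernel_on_def lessThan_empty_iff)
  qed
  then have "injections \<subseteq> (coordinate_kernel_operations :: 'a operation set)"
    by (auto simp: coordinate_kernel_operations_def injections_def)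
  then have "f \<in> coordinate_kernel_operations"
    using assms closed_function_clone_coordinate_kernel_operations unfolding Horn_clone_def by blast
  then show ?thesis
    using that by (auto simp: coordinate_kernel_operations_def)
qed

lemma Horn_clone_operations: "(Horn_clone :: 'a operation set) \<subseteq> operations"
  using closed_function_clone_Horn_clone[where 'a = 'a] by (simp add: closed_function_clone_def function_clone_def)

lemma Horn_clone_composition:
  fixes f :: "'a operation"
  assumes "f \<in> Horn_clone" "length gs = arity f" "\<And>g. g \<in> set gs \<Longrightarrow> g \<in> Horn_clone \<and> arity g = m"
  shows "composition m f gs \<in> Horn_clone"
  using closed_function_clone_Horn_clone[where 'a = 'a] assms
  by (simp add: closed_function_clone_def function_clone_def)

lemma Horn_clone_projection: "k < n \<Longrightarrow> projection n k \<in> (Horn_clone :: 'a operation set)"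
  using closed_function_clone_Horn_clone[where 'a = 'a] by (auto simp: closed_function_clone_def function_clone_def)

definition unary :: "('a \<Rightarrow> 'a) \<Rightarrow> 'a operation" where
  "unary f = (1, \<lambda>xs\<in>tuples 1. f (hd xs))"

lemma arity_unary [simp]: "arity (unary f) = 1"
  by (simp add: unary_def)

lemma fun_of_unary [simp]: "fun_of (unary f) [x] = f x"
  by (simp add: unary_def tuples_def)

lemma tuples_1: "xs \<in> tuples (Suc 0) \<longleftrightarrow> (\<exists>x. xs = [x])"
  by (auto simp: tuples_def length_Suc_conv)

lemma unary_operation: "unary f \<in> operations"
  by (simp add: unary_def operations_def)

lemma unary_in_Horn_clone:
  assumes "inj f"
  shows "unary f \<in> Horn_clone"
proof -
  have "inj_on (fun_of (unary f)) (tuples (arity (unary f)))"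
    using assms by (intro inj_onI) (auto simp: tuples_1 inj_eq)
  then show ?thesis
    using injections_subset_Horn_clone unary_operation[of f] by (auto simp: injections_def)
qed

lemma Horn_clone_unary:
  assumes "f \<in> Horn_clone" "arity f = 1"
  obtains a where "inj a" "f = unary a"
proof -
  obtain J where "kernel_on J f"
    using Horn_clone_kernel[OF assms(1)] .
  then have J: "J \<noteq> {}" "J \<subseteq> {0}"
    "\<And>x y. fun_of f [x] = fun_of f [y] \<longleftrightarrow> (\<forall>j\<in>J. [x] ! j = [y] ! j)"
    using assms(2) by (auto simp: kernel_on_def tuples_def)
  then have "J = {0}" by blast
  with J(3) have "inj (\<lambda>x. fun_of f [x])"
    by (auto simp: inj_def)
  moreover have "f = unary (\<lambda>x. fun_of f [x])"
    using assms Horn_clone_operations unary_operation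
    by (intro operation_eqI) (auto simp: tuples_1)
  ultimately show ?thesis
    using that by blast
qed

text \<open>
  Compose a bijection from \<open>D\<^sup>k\<close> onto \<open>D\<close>, where \<open>k\<close> is the size of \<open>J\<close>, with the projections to the
  coordinates in \<open>J\<close>. Being onto is what makes \<open>h\<close> useful: every operation with the same kernel
  is then \<open>a \<circ> h\<close> for an injection \<open>a\<close> defined on all of \<open>D\<close>.
\<close>

lemma ex_coordinate_coding:
  assumes cnt: "countable (UNIV :: 'a set)" and inf: "infinite (UNIV :: 'a set)"
    and J: "J \<noteq> {}" "J \<subseteq> {..<n}"
  obtains h :: "'a operation" where "h \<in> Horn_clone" "arity h = n" "kernel_on J h"
    "\<And>z. \<exists>xs\<in>tuples n. fun_of h xs = z"
proof -
  have "finite J"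
    using J(2) finite_subset by blast
  define js where "js = sorted_list_of_set J"
  define k where "k = length js"
  have js: "set js = J" "distinct js" and "0 < k"
    using \<open>finite J\<close> J(1) by (simp_all add: js_def k_def card_gt_0_iff)
  have "tuples k \<subseteq> lists (UNIV :: 'a set)"
    by auto
  then have cnt_k: "countable (tuples k :: 'a list set)"
    using countable_lists[OF cnt] countable_subset by blast
  have inf_k: "infinite (tuples k :: 'a list set)"
  proof -
    have "inj (\<lambda>a :: 'a. replicate k a)"
      using \<open>0 < k\<close> by (auto simp: inj_def)
    then have "infinite (range (\<lambda>a :: 'a. replicate k a))"
      using inf finite_imageD by blast
    moreover have "range (\<lambda>a :: 'a. replicate k a) \<subseteq> tuples k"
      by (auto simp: tuples_def)
    ultimately show ?thesis
      using infinite_super by blast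
  qed
  obtain b :: "'a list \<Rightarrow> 'a" where b: "bij_betw b (tuples k) UNIV"
    by (rule countable_infinite_bij_betw[OF cnt_k inf_k cnt inf])
  define B where "B = (k, restrict b (tuples k))"
  have "B \<in> operations"
    using \<open>0 < k\<close> by (auto simp: B_def operations_def)
  moreover have "inj_on (fun_of B) (tuples (arity B))"
    using b by (simp add: B_def bij_betw_def inj_on_def)
  ultimately have "B \<in> Horn_clone"
    using injections_subset_Horn_clone by (auto simp: injections_def)
  define h where "h = composition n B (map (projection n) js)"
  have "h \<in> Horn_clone"
    unfolding h_def using J(2) js(1) \<open>B \<in> Horn_clone\<close>
    by (intro Horn_clone_composition) (auto simp: B_def k_def projection_def[of n] intro!: Horn_clone_projection[unfolded projection_def])
  have "arity h = n"
    by (simp add: h_def composition_def)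
  have h: "fun_of h xs = b (map ((!) xs) js)" if "xs \<in> tuples n" for xs
    using that by (simp add: h_def composition_def B_def projection_def tuples_def k_def comp_def)
  have "fun_of h xs = fun_of h ys \<longleftrightarrow> (\<forall>j\<in>J. xs ! j = ys ! j)"
    if "xs \<in> tuples n" "ys \<in> tuples n" for xs ys
  proof -
    have "fun_of h xs = fun_of h ys \<longleftrightarrow> map ((!) xs) js = map ((!) ys) js"
      using inj_on_eq_iff[OF bij_betw_imp_inj_on[OF b], of "map ((!) xs) js" "map ((!) ys) js"] that
      by (simp add: h tuples_def k_def del: map_eq_conv)
    then show ?thesis
      by (simp add: js(1))
  qed
  with J \<open>arity h = n\<close> have "kernel_on J h"
    by (simp add: kernel_on_def)
  moreover have "\<exists>xs\<in>tuples n. fun_of h xs = z" for z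
  proof -
    obtain ys where ys: "ys \<in> tuples k" "b ys = z"
      using b by (metis UNIV_I bij_betw_imp_surj_on imageE)
    \<comment> \<open>Outside \<open>J\<close> the entries of \<open>xs\<close> are arbitrary.\<close>
    define xs where "xs = map (\<lambda>i. ys ! the_inv_into {..<k} ((!) js) i) [0..<n]"
    have "xs ! (js ! l) = ys ! l" if "l < k" for l
    proof -
      have "js ! l < n"
        using that js(1) J(2) nth_mem[of l js] by (auto simp: k_def)
      moreover have "the_inv_into {..<k} ((!) js) (js ! l) = l"
        using that js(2) by (intro the_inv_into_f_f) (auto simp: inj_on_def k_def nth_eq_iff_index_eq)
      ultimately show ?thesis
        by (simp add: xs_def)
    qed
    then have "map ((!) xs) js = ys"
      using ys(1) by (intro nth_equalityI) (auto simp: k_def tuples_def)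
    moreover have "xs \<in> tuples n"
      by (simp add: xs_def tuples_def)
    ultimately show ?thesis
      using h ys(2) by auto
  qed
  ultimately show ?thesis
    using that \<open>h \<in> Horn_clone\<close> \<open>arity h = n\<close> by blast
qed

text \<open>
  Whether the coordinate \<open>i\<close> belongs to the kernel can be read off from the values at a constant
  tuple and at the same tuple changed at \<open>i\<close>.
\<close>

lemma kernel_locally_constant:
  assumes "infinite (UNIV :: 'a set)" and f: "kernel_on J (f :: 'a operation)"
  obtains E where "finite E" "E \<subseteq> tuples (arity f)"
    "\<And>g K. agree_on E g f \<Longrightarrow> kernel_on K g \<Longrightarrow> K = J"
proof -
  obtain a b :: 'a where ab: "a \<noteq> b"
    using assms(1) by (metis finite.simps UNIV_eq_I singletonI)
  let ?n = "arity f"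
  define c where "c = replicate ?n a"
  define E where "E = insert c ((\<lambda>i. c[i := b]) ` {..<?n})"
  have E: "E \<subseteq> tuples ?n"
    by (auto simp: E_def c_def tuples_def)
  have detect: "i \<in> K \<longleftrightarrow> fun_of g c \<noteq> fun_of g (c[i := b])"
    if "kernel_on K g" "arity g = ?n" "i < ?n" for g K i
  proof -
    have "fun_of g c = fun_of g (c[i := b]) \<longleftrightarrow> (\<forall>j\<in>K. c ! j = c[i := b] ! j)"
      using that by (simp add: kernel_on_def c_def tuples_def)
    also have "\<dots> \<longleftrightarrow> i \<notin> K"
      using that ab by (auto simp: c_def nth_list_update kernel_on_def)
    finally show ?thesis by blast
  qed
  have "K = J" if g: "agree_on E g f" "kernel_on K g" for g K
  proof -
    have n: "arity g = ?n" "K \<subseteq> {..<?n}" "J \<subseteq> {..<?n}"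
      using g f by (auto simp: agree_on_def kernel_on_def)
    have "i \<in> K \<longleftrightarrow> i \<in> J" if "i < ?n" for i
      using detect[OF g(2) n(1) that] detect[OF f refl that] g(1) that by (simp add: agree_on_def E_def)
    with n show ?thesis by blast
  qed
  moreover have "finite E"
    by (simp add: E_def)
  ultimately show ?thesis
    using E that by blast
qed

section \<open>Isomorphisms from the Horn clone onto closed clones\<close>

locale Horn_clone_isomorphism =
  fixes C' :: "'a operation set" and \<xi> :: "'a operation \<Rightarrow> 'a operation"
  assumes countable_base: "countable (UNIV :: 'a set)"
    and infinite_base: "infinite (UNIV :: 'a set)"
    and closed_target: "closed_function_clone C'"
    and isomorphism: "clone_isomorphism Horn_clone C' \<xi>"
begin

lemma bij: "bij_betw \<xi> Horn_clone C'"
  and arity_image: "f \<in> Horn_clone \<Longrightarrow> arity (\<xi> f) = arity f"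
  and projection_image: "k < n \<Longrightarrow> \<xi> (projection n k) = projection n k"
  and composition_image: "f \<in> Horn_clone \<Longrightarrow> length gs = arity f \<Longrightarrow>
    \<forall>g\<in>set gs. g \<in> Horn_clone \<and> arity g = m \<Longrightarrow>
    \<xi> (composition m f gs) = composition m (\<xi> f) (map \<xi> gs)"
  using isomorphism by (auto simp: clone_isomorphism_def clone_homomorphism_def)

lemma target_operations: "C' \<subseteq> operations"
  and target_closed: "closedin operation_topology C'"
  using closed_target by (auto simp: closed_function_clone_def function_clone_def)

definition unary_rep :: "('a \<Rightarrow> 'a) \<Rightarrow> 'a \<Rightarrow> 'a" where
  "unary_rep f d = fun_of (\<xi> (unary f)) [d]"

text \<open>
  The unary part of the Horn clone is the monoid of injections, and the unary part of a closed
  clone is closed under pointwise limits.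
\<close>

sublocale closed_injection_monoid_representation unary_rep
proof
  show "unary_rep id = id"
  proof -
    have "unary id = (projection 1 0 :: 'a operation)"
      by (auto simp: unary_def projection_def tuples_def fun_eq_iff restrict_def length_Suc_conv)
    then show ?thesis
      by (simp add: unary_rep_def fun_eq_iff projection_image) (simp add: projection_def tuples_def)
  qed
  show "unary_rep (f \<circ> g) = unary_rep f \<circ> unary_rep g" if "inj f" "inj g" for f g
  proof -
    have "unary (f \<circ> g) = composition 1 (unary f) [unary g]"
      by (auto simp: unary_def composition_def tuples_def fun_eq_iff restrict_def)
    then have "\<xi> (unary (f \<circ> g)) = composition 1 (\<xi> (unary f)) [\<xi> (unary g)]"
      using composition_image[of "unary f" "[unary g]" 1] that[THEN unary_in_Horn_clone] by simp
    then show ?thesis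
      by (simp add: unary_rep_def fun_eq_iff composition_def tuples_def)
  qed
  show "f = g" if "inj f" "inj g" "unary_rep f = unary_rep g" for f g
  proof -
    have "\<xi> f \<in> operations" if "f \<in> Horn_clone" for f
      using that bij target_operations by (auto simp: bij_betw_def)
    then have "\<xi> (unary f) = \<xi> (unary g)"
      using that(3) arity_image that(1,2)[THEN unary_in_Horn_clone]
      by (intro operation_eqI) (auto simp: tuples_1 unary_rep_def fun_eq_iff)
    then have "unary f = unary g"
      using bij that(1,2) unary_in_Horn_clone by (metis bij_betw_def inj_onD)
    then show ?thesis
      by (metis ext fun_of_unary)
  qed
  show "\<exists>f. inj f \<and> unary_rep f = p"
    if p: "\<And>E. finite E \<Longrightarrow> \<exists>f. inj f \<and> (\<forall>d\<in>E. unary_rep f d = p d)" for p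
  proof -
    have "unary p \<in> C'"
    proof (rule closedin_operation_topologyD[OF target_closed unary_operation])
      fix E :: "'a list set" assume E: "finite E" "E \<subseteq> tuples (arity (unary p))"
      obtain f where f: "inj f" "\<And>d. d \<in> hd ` E \<Longrightarrow> unary_rep f d = p d"
        using p[of "hd ` E"] E(1) by blast
      have "fun_of (\<xi> (unary f)) t = fun_of (unary p) t" if t: "t \<in> E" for t
      proof -
        have "t \<in> tuples (Suc 0)"
          using E(2) t by auto
        then obtain d where "t = [d]"
          by (auto simp: tuples_1)
        with t f(2)[of d] show ?thesis
          by (force simp: unary_rep_def)
      qed
      moreover have "\<xi> (unary f) \<in> C'" "arity (\<xi> (unary f)) = 1"
        using bij unary_in_Horn_clone[OF f(1)] arity_image by (auto simp: bij_betw_def)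
      ultimately show "\<exists>g\<in>C'. agree_on E g (unary p)"
        by (intro bexI[of _ "\<xi> (unary f)"]) (auto simp: agree_on_def)
    qed
    then obtain g where g: "g \<in> Horn_clone" "\<xi> g = unary p"
      using bij by (metis bij_betw_imp_surj_on imageE)
    then have "arity g = 1"
      using arity_image by (metis arity_unary)
    then obtain f where "inj f" "g = unary f"
      using Horn_clone_unary g(1) by blast
    moreover from this g(2) have "unary_rep f = p"
      by (simp add: unary_rep_def fun_eq_iff)
    ultimately show ?thesis
      by blast
  qed
qed (use countable_base infinite_base in auto)

text \<open>
  Operations close to \<open>f\<close> have the same kernel \<open>J\<close> as \<open>f\<close>. If \<open>h\<close> is a fixed surjective operation
  with kernel \<open>J\<close>, each such operation is \<open>a \<circ> h\<close> for an injection \<open>a\<close> that depends continuously on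
  it. Since \<open>\<xi> (a \<circ> h)\<close> is the composition of \<open>\<xi> a\<close> with the constant \<open>\<xi> h\<close>, only the continuity
  of \<open>\<xi>\<close> on injections is needed.
\<close>

lemma isomorphism_continuous:
  assumes f: "f \<in> Horn_clone" and t: "t \<in> tuples (arity f)"
  shows "\<exists>E. finite E \<and> E \<subseteq> tuples (arity f) \<and>
    (\<forall>g\<in>Horn_clone. agree_on E g f \<longrightarrow> fun_of (\<xi> g) t = fun_of (\<xi> f) t)"
proof -
  let ?n = "arity f"
  obtain J where J: "kernel_on J f"
    using Horn_clone_kernel[OF f] .
  then have "J \<noteq> {}" "J \<subseteq> {..<?n}"
    by (auto simp: kernel_on_def)
  then obtain h :: "'a operation" where h: "h \<in> Horn_clone" "arity h = ?n" "kernel_on J h"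
    "\<And>z. \<exists>xs\<in>tuples ?n. fun_of h xs = z"
    using ex_coordinate_coding[OF countable_base infinite_base] by blast
  obtain s where s: "\<And>z. s z \<in> tuples ?n" "\<And>z. fun_of h (s z) = z"
    using h(4) by metis
  let ?a = "\<lambda>g z. fun_of g (s z)"
  have factor: "inj (?a g) \<and> fun_of (\<xi> g) t = unary_rep (?a g) (fun_of (\<xi> h) t)"
    if g: "g \<in> Horn_clone" "arity g = ?n" "kernel_on J g" for g
  proof -
    have same_kernel: "fun_of g xs = fun_of g ys \<longleftrightarrow> fun_of h xs = fun_of h ys"
      if "xs \<in> tuples ?n" "ys \<in> tuples ?n" for xs ys
      using that g(2,3) h(2,3) by (simp add: kernel_on_def)
    have "inj (?a g)"
      using same_kernel s by (metis injI)
    then have a: "unary (?a g) \<in> Horn_clone"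
      by (rule unary_in_Horn_clone)
    have "g = composition ?n (unary (?a g)) [h]"
    proof (rule operation_eqI)
      show "g \<in> operations"
        using g(1) Horn_clone_operations by blast
      show "composition ?n (unary (?a g)) [h] \<in> operations"
        using a h(1,2) Horn_clone_operations by (intro composition_in_operations) auto
      show "fun_of g xs = fun_of (composition ?n (unary (?a g)) [h]) xs"
        if "xs \<in> tuples (arity (composition ?n (unary (?a g)) [h]))" for xs
        using that same_kernel s by (simp add: composition_def)
    qed (simp add: g(2) composition_def)
    then have "\<xi> g = composition ?n (\<xi> (unary (?a g))) [\<xi> h]"
      using composition_image[OF a, of "[h]" ?n] h(1,2) by simp
    then have "fun_of (\<xi> g) t = unary_rep (?a g) (fun_of (\<xi> h) t)"
      using t by (simp add: composition_def unary_rep_def)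
    with \<open>inj (?a g)\<close> show ?thesis by simp
  qed
  obtain F where F: "supports F (fun_of (\<xi> h) t)"
    using ex_support by blast
  obtain E where E: "finite E" "E \<subseteq> tuples ?n"
    "\<And>g K. agree_on E g f \<Longrightarrow> kernel_on K g \<Longrightarrow> K = J"
    using kernel_locally_constant[OF infinite_base J] by metis
  have "fun_of (\<xi> g) t = fun_of (\<xi> f) t" if g: "g \<in> Horn_clone" "agree_on (E \<union> s ` F) g f" for g
  proof -
    have "agree_on E g f" "arity g = ?n"
      using g(2) by (auto simp: agree_on_def)
    then have "kernel_on J g"
      using E(3) Horn_clone_kernel[OF g(1)] by metis
    have "?a g x = ?a f x" if "x \<in> F" for x
      using that g(2) by (simp add: agree_on_def)
    then have "unary_rep (?a g) (fun_of (\<xi> h) t) = unary_rep (?a f) (fun_of (\<xi> h) t)"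
      using factor[OF g(1) \<open>arity g = ?n\<close> \<open>kernel_on J g\<close>] factor[OF f refl J]
      by (intro rep_continuous[OF F]) auto
    then show ?thesis
      using factor[OF g(1) \<open>arity g = ?n\<close> \<open>kernel_on J g\<close>] factor[OF f refl J] by simp
  qed
  moreover have "finite (E \<union> s ` F)" "E \<union> s ` F \<subseteq> tuples ?n"
    using E(1,2) F s(1) by (auto simp: supports_def)
  ultimately show ?thesis by blast
qed

text \<open>
  Choose permutations \<open>u i\<close> taking one point \<open>y\<close> to the entries of \<open>t\<close>. The diagonal operation
  \<open>g (u 0, u 1, \<dots>)\<close> is an injection with value \<open>g t\<close> at \<open>y\<close>, and its image under \<open>\<xi>\<close> is
  computed from \<open>\<xi> g\<close>. So openness in all arities follows from openness on injections.
\<close>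

lemma isomorphism_open:
  assumes f: "f \<in> Horn_clone" and t: "t \<in> tuples (arity f)"
  shows "\<exists>E. finite E \<and> E \<subseteq> tuples (arity f) \<and>
    (\<forall>g\<in>Horn_clone. agree_on E (\<xi> g) (\<xi> f) \<longrightarrow> fun_of g t = fun_of f t)"
proof -
  let ?n = "arity f"
  \<comment> \<open>An arbitrary point; the set of test tuples depends on it, the claim does not.\<close>
  fix y :: 'a
  define u where "u i = Transposition.transpose y (t ! i)" for i
  have u: "inj (u i)" "u i y = t ! i" for i
    by (simp_all add: u_def)
  let ?us = "map (\<lambda>i. unary (u i)) [0..<?n]"
  have us: "\<forall>v\<in>set ?us. v \<in> Horn_clone \<and> arity v = 1"
    using unary_in_Horn_clone[OF u(1)] by auto
  have diagonal: "\<exists>a. inj a \<and> a y = fun_of g t \<and>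
      (\<forall>d. unary_rep a d = fun_of (\<xi> g) (map (\<lambda>i. unary_rep (u i) d) [0..<?n]))"
    if g: "g \<in> Horn_clone" "arity g = ?n" for g
  proof -
    have "composition 1 g ?us \<in> Horn_clone"
      by (rule Horn_clone_composition[OF g(1)]) (simp add: g(2), rule us[rule_format])
    moreover have "arity (composition 1 g ?us) = 1"
      by (simp add: composition_def)
    ultimately obtain a where a: "inj a" "composition 1 g ?us = unary a"
      by (rule Horn_clone_unary)
    have "a y = fun_of (composition 1 g ?us) [y]"
      by (simp only: a(2) fun_of_unary)
    also have "\<dots> = fun_of g (map (\<lambda>i. t ! i) [0..<?n])"
      by (simp add: composition_def tuples_def comp_def u(2))
    also have "map (\<lambda>i. t ! i) [0..<?n] = t"
      using t map_nth[of t] by (simp add: tuples_def)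
    finally have "a y = fun_of g t" .
    moreover have "unary_rep a d = fun_of (\<xi> g) (map (\<lambda>i. unary_rep (u i) d) [0..<?n])" for d
    proof -
      have "\<xi> (composition 1 g ?us) = composition 1 (\<xi> g) (map \<xi> ?us)"
        by (rule composition_image[OF g(1) _ us]) (simp add: g(2))
      then have "\<xi> (unary a) = composition 1 (\<xi> g) (map \<xi> ?us)"
        by (simp only: a(2))
      then show ?thesis
        by (simp add: unary_rep_def composition_def tuples_def comp_def)
    qed
    ultimately show ?thesis
      using a(1) by blast
  qed
  obtain D where D: "finite D"
    "\<And>a b. inj a \<Longrightarrow> inj b \<Longrightarrow> (\<And>d. d \<in> D \<Longrightarrow> unary_rep a d = unary_rep b d) \<Longrightarrow> a y = b y"
    using rep_open[of y] by metis
  let ?E = "(\<lambda>d. map (\<lambda>i. unary_rep (u i) d) [0..<?n]) ` D"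
  have "fun_of g t = fun_of f t" if g: "g \<in> Horn_clone" "agree_on ?E (\<xi> g) (\<xi> f)" for g
  proof -
    have "arity g = ?n"
      using g f arity_image by (simp add: agree_on_def)
    then obtain a where a: "inj a" "a y = fun_of g t"
      "\<And>d. unary_rep a d = fun_of (\<xi> g) (map (\<lambda>i. unary_rep (u i) d) [0..<?n])"
      using diagonal[OF g(1)] by metis
    obtain b where b: "inj b" "b y = fun_of f t"
      "\<And>d. unary_rep b d = fun_of (\<xi> f) (map (\<lambda>i. unary_rep (u i) d) [0..<?n])"
      using diagonal[OF f refl] by metis
    have "unary_rep a d = unary_rep b d" if "d \<in> D" for d
      using that g(2) by (simp add: a(3) b(3) agree_on_def)
    then have "a y = b y"
      using D(2) a(1) b(1) by blast
    with a(2) b(2) show ?thesis by simp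
  qed
  moreover have "finite ?E" "?E \<subseteq> tuples ?n"
    using D(1) by (auto simp: tuples_def)
  ultimately show ?thesis by blast
qed

end

theorem proposition40:
  assumes "countable (UNIV :: 'a set)"
    and "infinite (UNIV :: 'a set)"
  shows "automatic_homeomorphicity (Horn_clone :: 'a operation set)"
  unfolding automatic_homeomorphicity_def
proof (intro allI impI)
  fix C' :: "'a operation set" and \<xi> :: "'a operation \<Rightarrow> 'a operation"
  assume "closed_function_clone C'" "clone_isomorphism Horn_clone C' \<xi>"
  with assms interpret Horn_clone_isomorphism C' \<xi>
    by unfold_locales
  show "homeomorphic_map (subtopology operation_topology Horn_clone) (subtopology operation_topology C') \<xi>"
    by (rule homeomorphic_map_operations[OF Horn_clone_operations target_operations bij arity_image
          isomorphism_continuous isomorphism_open])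
qed

end
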